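(* Let $n\ge3$. There is an open dense set $\mathcal{Q}\subset\mathcal{P}_n$ such that for any polygon $P\in\mathcal{Q}$, the glancing set $\mathcal{G}$ of $\omega_P$ is contained in the set of vertices of $P$, and all of these glancing points have order $1$ (with respect to every glancing line through them). In addition, for any $P\in\mathcal{P}_n$, there exist finitely many angles $\theta_1,\theta_2,\ldots,\theta_{j_0}\in\Theta(\omega_P)$ such that $R_\theta P\in\mathcal{Q}$ for any $\theta\in\Theta(\omega_P)\setminus\{\theta_1,\theta_2,\ldots,\theta_{j_0}\}$.
   Context: $\mathbb{T}^2=\mathbb{R}^2/\mathbb{Z}^2$; $\pi:\mathbb{R}^2\to\mathbb{T}^2$ is the projection. A bounded open set $\omega\subset\mathbb{R}^2$ is properly projected on the torus if $\pi|_{\overline{\omega}}$ is one-to-one. $R_\theta$ is the rotation of $\mathbb{R}^2$ by angle $\theta\in\mathbb{S}^1\simeq\mathbb{R}/2\pi\mathbb{Z}$, and $\Theta(\omega)=\{\theta\in\mathbb{S}^1: R_\theta\omega\text{ is properly projected on the torus}\}$. All sets are considered up to translation (none of the notions here depend on translation). Polygons: up to translation, a polygon with $n$ vertices is a list $P=(v_1,\ldots,v_n)$ of vectors $v_j\in\mathbb{R}^2$ (its oriented edges, in order) with $v_1+\cdots+v_n=0$; these form a $(2n-2)$-dimensional subspace $\mathcal{H}_n\subset\mathbb{R}^{2n}$, with the usual topology. $P$ is non-degenerate if all $v_j\ne0$; it has no self-intersections if the closed polygonal curve it defines is simple. For $P$ without self-intersections, $\omega_P\subset\mathbb{R}^2$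 is the open region enclosed by the edges. $\mathcal{P}_n\subset\mathcal{H}_n$ is the (open) set of non-degenerate polygons without self-intersections such that $\omega_P$ is properly projected on the torus; for such $P$, $\omega_P$ is identified with $\pi(\omega_P)\subset\mathbb{T}^2$. $R_\theta P=(R_\theta v_1,\ldots,R_\theta v_n)$. Glancing: let $\omega\subset\mathbb{T}^2$ be open. For $z\in\mathbb{T}^2$, $v\in\mathbb{S}^1$, $L_{z,v}=\{z+tv:t\in\mathbb{R}\}\subset\mathbb{T}^2$. A line $L$ is glancing if $L\cap\omega=\varnothing$ and $L\cap\partial\omega\ne\varnothing$. The glancing set $\mathcal{G}$ of $\omega$ is the set of $z\in\partial\omega$ lying on some glancing line. If $L$ is a glancing line with direction $v$ and $z\in L\cap\partial\omega$, then $z$ is a one-sided glancing point relative to $v$ if there exist a neighborhood $U$ of $z$, $w\in\mathbb{S}^1$ with $v\cdot w=0$, and $\varepsilon_0>0$ such that $L_{z+sw,v}\cap U\cap\omega=\varnothing$ for all $s\in(0,\varepsilon_0)$; otherwise $z$ is two-sided relative to $v$. Order: let $L$ be a glancing line, $z\in\partial\omega\cap L$, $\eta>0$. The point $z$ has order $\eta$ (with respect to $L$) if there is an affine coordinate chart $(\psi,U)$ about $z$ (i.e. $U=\pi(\widetilde U)\ni z$ with $\widetilde U\subset\mathbb{R}^2$ open, $\pi|_{\widetilde U}$ injective, and $\psi\circ\pi|_{\widetilde U}$ the restriction of an invertible affine map of $\mathbb{R}^2$) with $\psi(z)=(0,0)$ and $\psi(L\cap U)=\{(x,y)\in\psi(U):x=0\}$,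 and there are constants $C_{out}>C_{in}>1$ such that, with $$\Omega_\eta=\{(x,y)\in\psi(U):|y|^\eta\le C_{out}|x|\},\qquad \mathcal{F}_\eta=\{(x,y)\in\psi(U)\setminus\{(0,0)\}:C_{in}^{-1}|y|^\eta\le|x|\le C_{in}|y|^\eta\},$$ one has: if $z$ is one-sided relative to the direction of $L$, then $\mathcal{F}_\eta\cap\{x\ge0,y\ge0\}\subset\psi(\omega\cap U)\subset\Omega_\eta\cap\{x\ge0\}$; if $z$ is two-sided relative to the direction of $L$, then either $\mathcal{F}_\eta\cap\{y\ge0\}\subset\psi(\omega\cap U)\subset\Omega_\eta$ or $\mathcal{F}_\eta\cap\{xy\ge0\}\subset\psi(\omega\cap U)\subset\Omega_\eta$. *)

theory Defs
  imports "HOL-Analysis.Analysis"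
begin

text \<open>
  The plane is the type \<^typ>\<open>complex\<close>, regarded as a real inner product space with coordinates
  \<^const>\<open>Re\<close> and \<^const>\<open>Im\<close>; unit vectors are the complex numbers of norm 1.
\<close>

section \<open>The torus\<close>

quotient_type torus = complex / "\<lambda>z w. Re (z - w) \<in> \<int> \<and> Im (z - w) \<in> \<int>"
  morphisms rep_torus proj
proof (rule equivpI)
  show "reflp (\<lambda>z w. Re (z - w) \<in> \<int> \<and> Im (z - w) \<in> \<int>)"
    by (auto intro: reflpI)
  show "symp (\<lambda>z w. Re (z - w) \<in> \<int> \<and> Im (z - w) \<in> \<int>)"
    by (rule sympI) (metis Ints_minus minus_diff_eq minus_complex.simps)
  show "transp (\<lambda>z w. Re (z - w) \<in> \<int> \<and> Im (z - w) \<in> \<int>)"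
  proof (rule transpI)
    fix x y z :: complex
    assume "Re (x - y) \<in> \<int> \<and> Im (x - y) \<in> \<int>" "Re (y - z) \<in> \<int> \<and> Im (y - z) \<in> \<int>"
    then have "Re (x - y) + Re (y - z) \<in> \<int>" "Im (x - y) + Im (y - z) \<in> \<int>"
      by (blast intro: Ints_add)+
    then show "Re (x - z) \<in> \<int> \<and> Im (x - z) \<in> \<int>" by simp
  qed
qed

text \<open>The topology is the quotient topology.\<close>

instantiation torus :: topological_space
begin

definition open_torus :: "torus set \<Rightarrow> bool"
  where "open_torus U \<longleftrightarrow> open (proj -` U)"

instance
  by standard (auto simp: open_torus_def vimage_Union)

end

instantiation torus :: ab_group_add
begin

lift_definition zero_torus :: torus is 0 .

lift_definition plus_torus :: "torus \<Rightarrow> torus \<Rightarrow> torus" is "(+)"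
proof -
  fix a b c d :: complex
  assume "Re (a - b) \<in> \<int> \<and> Im (a - b) \<in> \<int>" "Re (c - d) \<in> \<int> \<and> Im (c - d) \<in> \<int>"
  then have "Re (a - b) + Re (c - d) \<in> \<int>" "Im (a - b) + Im (c - d) \<in> \<int>"
    by (blast intro: Ints_add)+
  then show "Re (a + c - (b + d)) \<in> \<int> \<and> Im (a + c - (b + d)) \<in> \<int>"
    by (simp add: algebra_simps)
qed

lift_definition uminus_torus :: "torus \<Rightarrow> torus" is uminus
proof -
  fix a b :: complex
  assume "Re (a - b) \<in> \<int> \<and> Im (a - b) \<in> \<int>"
  then have "- Re (a - b) \<in> \<int>" "- Im (a - b) \<in> \<int>"
    by (blast intro: Ints_minus)+
  then show "Re (- a - - b) \<in> \<int> \<and> Im (- a - - b) \<in> \<int>" by simp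
qed

definition minus_torus :: "torus \<Rightarrow> torus \<Rightarrow> torus"
  where "minus_torus z w = z + - w"

instance
proof
  fix a b c :: torus
  show "a + b + c = a + (b + c)" by transfer (simp add: algebra_simps)
  show "a + b = b + a" by transfer (simp add: algebra_simps)
  show "0 + a = a" by transfer simp
  show "- a + a = 0" by transfer simp
  show "a - b = a + - b" by (rule minus_torus_def)
qed

end

lemma proj_eq_iff: "proj z = proj w \<longleftrightarrow> Re (z - w) \<in> \<int> \<and> Im (z - w) \<in> \<int>"
  by (rule torus.abs_eq_iff)

lemma proj_add: "proj (z + w) = proj z + proj w"
  by (simp add: plus_torus.abs_eq)

section \<open>Properly projected sets\<close>

definition properly_projected :: "complex set \<Rightarrow> bool"
  where "properly_projected \<omega> \<longleftrightarrow> bounded \<omega> \<and> open \<omega> \<and> inj_on proj (closure \<omega>)"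

definition rot :: "real \<Rightarrow> complex \<Rightarrow> complex"
  where "rot \<theta> z = cis \<theta> * z"

text \<open>Angles modulo \<open>2\<pi>\<close> are represented in \<open>[0, 2\<pi>)\<close>.\<close>

definition Theta :: "complex set \<Rightarrow> real set"
  where "Theta \<omega> = {\<theta> \<in> {0..<2*pi}. properly_projected (rot \<theta> ` \<omega>)}"

section \<open>Polygons\<close>

text \<open>
  A list of \<open>n\<close> edge vectors is a sequence \<open>P\<close> of which only \<open>P 0, \<dots>, P (n - 1)\<close> may be non-zero.
  The topology on these sequences is the one inherited from the product topology
  on \<^typ>\<open>nat \<Rightarrow> complex\<close>; since all other entries vanish, it is the usual topology
  of a linear subspace of \<open>\<real>\<^sup>2\<^sup>n\<close>.
\<close>

definition polygons :: "nat \<Rightarrow> (nat \<Rightarrow> complex) set"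
  where "polygons n = {P. (\<forall>j\<ge>n. P j = 0) \<and> (\<Sum>j<n. P j) = 0}"

definition nondegenerate :: "nat \<Rightarrow> (nat \<Rightarrow> complex) \<Rightarrow> bool"
  where "nondegenerate n P \<longleftrightarrow> (\<forall>j<n. P j \<noteq> 0)"

text \<open>The translate whose initial vertex is the origin represents the polygon.\<close>

definition vertex :: "(nat \<Rightarrow> complex) \<Rightarrow> nat \<Rightarrow> complex"
  where "vertex P k = (\<Sum>j<k. P j)"

text \<open>
  For \<open>k < n\<close>, the parameter interval \<open>[k/n, (k+1)/n]\<close> runs affinely through the edge
  from \<open>vertex P k\<close> to \<open>vertex P (k + 1)\<close>.
\<close>

definition polygon_curve :: "nat \<Rightarrow> (nat \<Rightarrow> complex) \<Rightarrow> real \<Rightarrow> complex"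
  where "polygon_curve n P t =
    (let k = nat \<lfloor>real n * t\<rfloor> in vertex P k + (real n * t - real k) *\<^sub>R P k)"

definition no_self_intersections :: "nat \<Rightarrow> (nat \<Rightarrow> complex) \<Rightarrow> bool"
  where "no_self_intersections n P \<longleftrightarrow> simple_path (polygon_curve n P)"

definition region :: "nat \<Rightarrow> (nat \<Rightarrow> complex) \<Rightarrow> complex set"
  where "region n P = inside (path_image (polygon_curve n P))"

definition proper_polygons :: "nat \<Rightarrow> (nat \<Rightarrow> complex) set"
  where "proper_polygons n = {P \<in> polygons n.
    nondegenerate n P \<and> no_self_intersections n P \<and> properly_projected (region n P)}"

definition torus_region :: "nat \<Rightarrow> (nat \<Rightarrow> complex) \<Rightarrow> torus set"
  where "torus_region n P = proj ` region n P"

definition torus_vertices :: "nat \<Rightarrow> (nat \<Rightarrow> complex) \<Rightarrow> torus set"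
  where "torus_vertices n P = (\<lambda>k. proj (vertex P k)) ` {..<n}"

definition rot_polygon :: "real \<Rightarrow> (nat \<Rightarrow> complex) \<Rightarrow> nat \<Rightarrow> complex"
  where "rot_polygon \<theta> P = (\<lambda>j. rot \<theta> (P j))"

section \<open>Glancing\<close>

definition torus_line :: "torus \<Rightarrow> complex \<Rightarrow> torus set"
  where "torus_line z v = {z + proj (t *\<^sub>R v) |t. True}"

text \<open>
  A line is given as a point set \<open>L\<close> together with a unit direction \<open>v\<close>; the set determines
  \<open>v\<close> up to sign, and replacing \<open>v\<close> by \<open>- v\<close> changes none of the notions below.
\<close>

definition glancing_line :: "torus set \<Rightarrow> complex \<Rightarrow> torus set \<Rightarrow> bool"
  where "glancing_line \<omega> v L \<longleftrightarrow>
    norm v = 1 \<and> (\<exists>z. L = torus_line z v) \<and> L \<inter> \<omega> = {} \<and> L \<inter> frontier \<omega> \<noteq> {}"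

definition glancing_set :: "torus set \<Rightarrow> torus set"
  where "glancing_set \<omega> = {z \<in> frontier \<omega>. \<exists>v L. glancing_line \<omega> v L \<and> z \<in> L}"

definition one_sided :: "torus set \<Rightarrow> torus \<Rightarrow> complex \<Rightarrow> bool"
  where "one_sided \<omega> z v \<longleftrightarrow>
    (\<exists>U w \<epsilon>. open U \<and> z \<in> U \<and> norm w = 1 \<and> v \<bullet> w = 0 \<and> 0 < \<epsilon> \<and>
      (\<forall>s\<in>{0<..<\<epsilon>}. torus_line (z + proj (s *\<^sub>R w)) v \<inter> U \<inter> \<omega> = {}))"

abbreviation two_sided :: "torus set \<Rightarrow> torus \<Rightarrow> complex \<Rightarrow> bool"
  where "two_sided \<omega> z v \<equiv> \<not> one_sided \<omega> z v"

section \<open>Order of a glancing point\<close>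

text \<open>Only the values of \<open>\<psi>\<close> on \<open>U\<close> are relevant.\<close>

definition affine_chart :: "(torus \<Rightarrow> complex) \<Rightarrow> torus set \<Rightarrow> bool"
  where "affine_chart \<psi> U \<longleftrightarrow>
    (\<exists>U' A b. open U' \<and> inj_on proj U' \<and> U = proj ` U' \<and>
      linear A \<and> bij A \<and> (\<forall>x\<in>U'. \<psi> (proj x) = A x + b))"

text \<open>In the next two definitions \<open>V\<close> plays the role of \<open>\<psi>(U)\<close>, and \<open>x = Re p\<close>, \<open>y = Im p\<close>.\<close>

definition order_outer :: "complex set \<Rightarrow> real \<Rightarrow> real \<Rightarrow> complex set"
  where "order_outer V \<eta> C = {p \<in> V. \<bar>Im p\<bar> powr \<eta> \<le> C * \<bar>Re p\<bar>}"

definition order_inner :: "complex set \<Rightarrow> real \<Rightarrow> real \<Rightarrow> complex set"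
  where "order_inner V \<eta> C =
    {p \<in> V - {0}. inverse C * \<bar>Im p\<bar> powr \<eta> \<le> \<bar>Re p\<bar> \<and> \<bar>Re p\<bar> \<le> C * \<bar>Im p\<bar> powr \<eta>}"

definition has_order :: "torus set \<Rightarrow> complex \<Rightarrow> torus set \<Rightarrow> torus \<Rightarrow> real \<Rightarrow> bool"
  where "has_order \<omega> v L z \<eta> \<longleftrightarrow>
    glancing_line \<omega> v L \<and> z \<in> frontier \<omega> \<inter> L \<and> 0 < \<eta> \<and>
    (\<exists>\<psi> U C_out C_in. affine_chart \<psi> U \<and> z \<in> U \<and> \<psi> z = 0 \<and>
      \<psi> ` (L \<inter> U) = {p \<in> \<psi> ` U. Re p = 0} \<and> C_out > C_in \<and> C_in > 1 \<and>
      (one_sided \<omega> z v \<longrightarrow>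
        order_inner (\<psi> ` U) \<eta> C_in \<inter> {p. 0 \<le> Re p \<and> 0 \<le> Im p} \<subseteq> \<psi> ` (\<omega> \<inter> U) \<and>
        \<psi> ` (\<omega> \<inter> U) \<subseteq> order_outer (\<psi> ` U) \<eta> C_out \<inter> {p. 0 \<le> Re p}) \<and>
      (two_sided \<omega> z v \<longrightarrow>
        (order_inner (\<psi> ` U) \<eta> C_in \<inter> {p. 0 \<le> Im p} \<subseteq> \<psi> ` (\<omega> \<inter> U) \<and>
         \<psi> ` (\<omega> \<inter> U) \<subseteq> order_outer (\<psi> ` U) \<eta> C_out) \<or>
        (order_inner (\<psi> ` U) \<eta> C_in \<inter> {p. 0 \<le> Re p * Im p} \<subseteq> \<psi> ` (\<omega> \<inter> U) \<and>
         \<psi> ` (\<omega> \<inter> U) \<subseteq> order_outer (\<psi> ` U) \<eta> C_out)))"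

end

theory Submission
  imports Defs "HOL-Complex_Analysis.Winding_Numbers"
begin

text \<open>
  The generic polygons are those whose region contains a disc that every line parallel to an edge
  meets, in the following robust sense. A line on the torus with a unit direction \<open>v\<close> lifts to a family
  of parallel lines that is invariant under \<open>\<int> + \<int> \<i>\<close>. If some lattice vector \<open>m\<close> has a
  component \<open>cross v m\<close> across \<open>v\<close>
  with \<open>0 < \<bar>cross v m\<bar> < d\<close>, the multiples of \<open>m\<close> spread the family so densely that it meets every
  disc of radius \<open>d\<close> (\<open>sweeping_line_meets_ball\<close>); such directions are called sweeping. By Dirichlet's theorem this happens for all but
  finitely many directions (\<open>finite_not_sweeping\<close>). The existence of such an \<open>m\<close> treats
  rational and irrational directions alike and, unlike rationality of the slope, is an open condition
  on \<open>v\<close>.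

  For a generic polygon a glancing line is transversal to all edges. Near a boundary point on
  such a line the polygon consists of two rays, where a point in the interior of an edge has
  opposite ones. Since the line misses the region, both rays lie on the same side of it and
  the region is the convex sector between them (\<open>inside_is_sector\<close>). Hence the point is a
  vertex. It has order 1, because an affine map takes the sector to \<open>0 < y < 2 x\<close> and the line to
  \<open>x = 0\<close>, while the same absence of small sideways shifts shows that only one strand of the glancing
  line passes near the point (\<open>sector_glancing_order_1\<close>).

  Openness follows from openness of the condition on the edges and from stability of discs in
  the region, seen by winding numbers (\<open>region_contains_ball_stable\<close>). Rotating a polygon keeps the radius of
  the disc, so all but finitely many admissible rotations make it generic
  (\<open>finite_nongeneric_rotations\<close>). As proper projection survives small rotations, density follows.
\<close>

section \<open>The covering of the torus by the plane\<close>

definition Gauss_ints :: "complex set"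
  where "Gauss_ints = {m. Re m \<in> \<int> \<and> Im m \<in> \<int>}"

lemma zero_Gauss_ints [simp]: "0 \<in> Gauss_ints"
  by (simp add: Gauss_ints_def)

lemma Gauss_ints_diff: "\<lbrakk>m \<in> Gauss_ints; k \<in> Gauss_ints\<rbrakk> \<Longrightarrow> m - k \<in> Gauss_ints"
  by (simp add: Gauss_ints_def)

lemma Gauss_ints_multiple: "m \<in> Gauss_ints \<Longrightarrow> of_int k * m \<in> Gauss_ints"
  by (simp add: Gauss_ints_def)

lemma Gauss_ints_norm_ge_1:
  assumes "m \<in> Gauss_ints" "m \<noteq> 0"
  shows "1 \<le> norm m"
proof (cases "Re m = 0")
  case True
  then have "Im m \<noteq> 0" using assms(2) by (simp add: complex_eq_iff)
  then have "1 \<le> \<bar>Im m\<bar>" using assms(1) by (auto simp: Gauss_ints_def elim!: Ints_nonzero_abs_ge1)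
  then show ?thesis using abs_Im_le_cmod order_trans by blast
next
  case False
  then have "1 \<le> \<bar>Re m\<bar>" using assms(1) by (auto simp: Gauss_ints_def elim!: Ints_nonzero_abs_ge1)
  then show ?thesis using abs_Re_le_cmod order_trans by blast
qed

lemma closed_subset_Gauss_ints:
  assumes "M \<subseteq> Gauss_ints"
  shows "closed M"
proof (rule discrete_imp_closed[of 1])
  show "\<forall>x\<in>M. \<forall>y\<in>M. dist y x < 1 \<longrightarrow> y = x"
  proof (intro ballI impI)
    fix x y assume "x \<in> M" "y \<in> M" "dist y x < 1"
    then show "y = x"
      using Gauss_ints_norm_ge_1[of "y - x"] Gauss_ints_diff[of y x] assms
      by (auto simp: dist_norm)
  qed
qed simp

lemma proj_eq_iff_Gauss: "proj z = proj w \<longleftrightarrow> z - w \<in> Gauss_ints"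
  by (simp add: proj_eq_iff Gauss_ints_def)

lemma proj_surj: "\<exists>z. \<tau> = proj z"
  by (induct \<tau> rule: torus.abs_induct) auto

lemma vimage_proj_image: "proj -` (proj ` S) = (\<Union>x\<in>S. \<Union>m\<in>Gauss_ints. {x + m})"
proof -
  have "proj p = proj x \<longleftrightarrow> (\<exists>m\<in>Gauss_ints. p = x + m)" for p x
    unfolding proj_eq_iff_Gauss by (metis add.commute add_diff_cancel_left' diff_add_cancel)
  then show ?thesis by (auto simp: image_iff vimage_def)
qed

lemma open_proj_image:
  assumes "open S"
  shows "open (proj ` S)"
proof -
  have "proj -` (proj ` S) = (\<Union>m\<in>Gauss_ints. (+) m ` S)"
    by (auto simp: vimage_proj_image add.commute)
  moreover have "open ((+) m ` S)" for m
    using assms open_translation by blast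
  ultimately show ?thesis by (simp add: open_torus_def open_UN)
qed

lemma closed_proj_image:
  assumes "compact K"
  shows "closed (proj ` K)"
proof -
  have "closed (proj -` (proj ` K))"
    unfolding vimage_proj_image
    using assms compact_closed_sums closed_subset_Gauss_ints by blast
  then show ?thesis
    by (simp add: closed_def open_torus_def vimage_Compl)
qed

lemma frontier_proj_image:
  assumes "bounded \<omega>" "open \<omega>"
  shows "frontier (proj ` \<omega>) \<subseteq> proj ` frontier \<omega>"
proof
  fix \<tau> assume \<tau>: "\<tau> \<in> frontier (proj ` \<omega>)"
  have "closure (proj ` \<omega>) \<subseteq> proj ` closure \<omega>"
    using assms closure_subset by (intro closure_minimal closed_proj_image image_mono) auto
  then obtain z where z: "z \<in> closure \<omega>" "\<tau> = proj z"
    using \<tau> by (auto simp: frontier_def)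
  moreover have "\<tau> \<notin> proj ` \<omega>"
    using \<tau> interior_open[OF open_proj_image[OF assms(2)]] by (auto simp: frontier_def)
  ultimately show "\<tau> \<in> proj ` frontier \<omega>"
    using assms(2) by (auto simp: frontier_def interior_open)
qed

lemma inj_on_proj_iff: "inj_on proj S \<longleftrightarrow> (\<forall>x\<in>S. \<forall>y\<in>S. x - y \<in> Gauss_ints \<longrightarrow> x = y)"
  by (auto simp: inj_on_def proj_eq_iff_Gauss)

lemma inj_on_proj_ball: "r \<le> 1/2 \<Longrightarrow> inj_on proj (ball z r)"
proof -
  assume r: "r \<le> 1/2"
  have "x = y" if "x \<in> ball z r" "y \<in> ball z r" "x - y \<in> Gauss_ints" for x y
  proof (rule ccontr)
    assume "x \<noteq> y"
    then have "1 \<le> dist x y" using Gauss_ints_norm_ge_1[of "x - y"] that by (simp add: dist_norm)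
    then show False using that r dist_triangle3[of x y z] by auto
  qed
  then show ?thesis by (auto simp: inj_on_proj_iff)
qed

text \<open>
  Proper projection means that no translate of \<open>closure \<omega>\<close> by a non-zero lattice vector passes
  through \<open>z\<close>. The union of these translates is closed, being a compact set plus a closed set, so it
  stays away from a whole disc about \<open>z\<close>. Hence near \<open>proj z\<close> the torus region looks exactly
  like the plane region near \<open>z\<close>.
\<close>
lemma properly_projected_local:
  assumes "properly_projected \<omega>" "z \<in> closure \<omega>"
  obtains r where "r > 0"
    "\<And>p. \<lbrakk>p \<in> ball z r; proj p \<in> proj ` \<omega>\<rbrakk> \<Longrightarrow> p \<in> \<omega>"
proof -
  let ?K = "closure \<omega>" and ?M = "Gauss_ints - {0}"
  have K: "compact ?K" and inj: "inj_on proj ?K"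
    using assms(1) by (auto simp: properly_projected_def)
  have "closed (\<Union>x\<in>?K. \<Union>m\<in>?M. {x + m})"
    using K by (intro compact_closed_sums closed_subset_Gauss_ints) auto
  moreover have "z \<notin> (\<Union>x\<in>?K. \<Union>m\<in>?M. {x + m})"
  proof
    assume "z \<in> (\<Union>x\<in>?K. \<Union>m\<in>?M. {x + m})"
    then obtain x m where "x \<in> ?K" "m \<in> ?M" "z = x + m" by auto
    moreover from this have "z - x \<in> Gauss_ints" by simp
    ultimately have "z = x" using inj assms(2) unfolding inj_on_proj_iff by blast
    with \<open>z = x + m\<close> \<open>m \<in> ?M\<close> show False by simp
  qed
  ultimately obtain r where r: "r > 0" "ball z r \<inter> (\<Union>x\<in>?K. \<Union>m\<in>?M. {x + m}) = {}"
    by (metis open_contains_ball ComplI closed_def disjoint_eq_subset_Compl)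
  show thesis
  proof (rule that[OF r(1)])
    fix p assume p: "p \<in> ball z r" "proj p \<in> proj ` \<omega>"
    then obtain x where x: "x \<in> \<omega>" "p - x \<in> Gauss_ints" by (auto simp: proj_eq_iff_Gauss)
    show "p \<in> \<omega>"
    proof (cases "p = x")
      case False
      then have "x \<in> ?K" "p - x \<in> ?M" "p = x + (p - x)"
        using x closure_subset by auto
      then have "p \<in> (\<Union>x\<in>?K. \<Union>m\<in>?M. {x + m})" by blast
      with p r show ?thesis by blast
    qed (use x in simp)
  qed
qed

section \<open>Lines that meet every disc of a given radius\<close>

text \<open>
  For a unit vector \<open>v\<close>, \<open>v \<bullet> q\<close> and \<open>cross v q\<close> are the coordinates of \<open>q\<close> along and
  across \<open>v\<close>; the lines of direction \<open>v\<close> are the level sets of \<open>cross v\<close>.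
\<close>
definition cross :: "complex \<Rightarrow> complex \<Rightarrow> real"
  where "cross v q = Im (cnj v * q)"

lemma linear_cross: "linear (cross v)"
  unfolding cross_def by (intro linearI) (auto simp: algebra_simps)

lemmas cross_simps [simp] =
  linear_add[OF linear_cross] linear_diff[OF linear_cross] linear_scale[OF linear_cross]
  linear_0[OF linear_cross] linear_neg[OF linear_cross]

lemma cross_self [simp]: "cross v v = 0"
  by (simp add: cross_def)

lemma abs_cross_le: "\<bar>cross v q\<bar> \<le> norm v * norm q"
  unfolding cross_def by (metis abs_Im_le_cmod complex_mod_cnj norm_mult)

lemma cross_scale_left: "cross (c *\<^sub>R v) q = c * cross v q"
  by (simp add: cross_def algebra_simps)

lemma unit_decomposition:
  assumes "norm v = 1"
  shows "q = (v \<bullet> q) *\<^sub>R v + cross v q *\<^sub>R (\<i> * v)"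
proof -
  have "(Re v)\<^sup>2 + (Im v)\<^sup>2 = 1" using assms by (metis cmod_power2 one_power2)
  then have *: "Re v * Re v + Im v * Im v = 1" by (simp add: power2_eq_square)
  have "(v \<bullet> q) *\<^sub>R v + cross v q *\<^sub>R (\<i> * v) = complex_of_real (Re v * Re v + Im v * Im v) * q"
    by (simp add: complex_eq_iff cross_def inner_complex_def algebra_simps)
  then show ?thesis unfolding * by simp
qed

lemma parallel_if_cross_zero:
  assumes "norm v = 1" "cross v q = 0"
  shows "q = (v \<bullet> q) *\<^sub>R v"
  using unit_decomposition[OF assms(1), of q] assms(2) by simp

text \<open>
  The lift to the plane of a line of direction \<open>v\<close> is invariant under lattice translations. A lattice
  vector \<open>m\<close> as below moves the line sideways by a non-zero distance less than \<open>d\<close>, so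
  its multiples leave gaps narrower than \<open>d\<close>. The bound scales with \<open>norm v\<close>, which makes
  the notion applicable to edge vectors of any length. For fixed \<open>m\<close> the condition is open in
  \<open>v\<close> and survives a small decrease of \<open>d\<close>, which is what makes genericity stable.
\<close>
definition sweeping :: "real \<Rightarrow> complex \<Rightarrow> bool"
  where "sweeping d v \<longleftrightarrow> (\<exists>m\<in>Gauss_ints. 0 < \<bar>cross v m\<bar> \<and> \<bar>cross v m\<bar> < d * norm v)"

lemma sweeping_scale:
  assumes "c \<noteq> 0"
  shows "sweeping d (c *\<^sub>R v) \<longleftrightarrow> sweeping d v"
proof -
  have 1: "\<bar>cross (c *\<^sub>R v) m\<bar> = \<bar>c\<bar> * \<bar>cross v m\<bar>" for m
    by (simp add: cross_scale_left abs_mult)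
  have 2: "d * norm (c *\<^sub>R v) = \<bar>c\<bar> * (d * norm v)" by simp
  show ?thesis
    unfolding sweeping_def 1 2 using assms by (simp add: zero_less_mult_iff)
qed

lemma sweeping_line_meets_ball:
  assumes v: "norm v = 1" and "sweeping d v"
  shows "torus_line (proj z) v \<inter> proj ` ball c d \<noteq> {}"
proof -
  obtain m where m: "m \<in> Gauss_ints" "0 < \<bar>cross v m\<bar>" "\<bar>cross v m\<bar> < d"
    using assms by (auto simp: sweeping_def)
  \<comment> \<open>Shifting by \<open>k * m\<close> brings the line to within \<open>d\<close> of the centre \<open>c\<close>; \<open>p\<close> is the foot of the perpendicular from \<open>c\<close>.\<close>
  define k where "k = \<lfloor>cross v (c - z) / cross v m\<rfloor>"
  define q where "q = c - z - of_int k * m"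
  have "cross v (of_int k * m) = of_int k * cross v m"
    by (simp add: cross_def algebra_simps)
  then have "cross v q = (cross v (c - z) / cross v m - of_int k) * cross v m"
    using m(2) by (simp add: q_def left_diff_distrib del: cross_simps)
      (simp add: algebra_simps)
  moreover have "\<bar>cross v (c - z) / cross v m - of_int k\<bar> \<le> 1"
    unfolding k_def by linarith
  ultimately have "\<bar>cross v q\<bar> \<le> 1 * \<bar>cross v m\<bar>"
    by (metis abs_mult abs_ge_zero mult_right_mono)
  with m have d: "\<bar>cross v q\<bar> < d" by linarith
  define p where "p = z + of_int k * m + (v \<bullet> q) *\<^sub>R v"
  have "c - p = cross v q *\<^sub>R (\<i> * v)"
    using unit_decomposition[OF v, of q] by (simp add: p_def q_def algebra_simps)
  then have "p \<in> ball c d" using d v by (simp add: dist_norm norm_mult)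
  moreover have "proj p = proj z + proj ((v \<bullet> q) *\<^sub>R v)"
    using m(1) by (simp add: p_def flip: proj_add) (simp add: proj_eq_iff_Gauss Gauss_ints_multiple)
  ultimately show ?thesis unfolding torus_line_def by blast
qed

lemma finite_Gauss_ints_bounded: "finite {m \<in> Gauss_ints. norm m \<le> R}"
proof -
  have "finite ((\<lambda>(a, b). Complex (real_of_int a) (of_int b)) ` ({-\<lceil>R\<rceil>..\<lceil>R\<rceil>} \<times> {-\<lceil>R\<rceil>..\<lceil>R\<rceil>}))"
    by simp
  moreover have "{m \<in> Gauss_ints. norm m \<le> R} \<subseteq>
      (\<lambda>(a, b). Complex (real_of_int a) (of_int b)) ` ({-\<lceil>R\<rceil>..\<lceil>R\<rceil>} \<times> {-\<lceil>R\<rceil>..\<lceil>R\<rceil>})"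
  proof
    fix m assume m: "m \<in> {m \<in> Gauss_ints. norm m \<le> R}"
    then obtain a b where ab: "Re m = of_int a" "Im m = of_int b"
      by (auto simp: Gauss_ints_def elim!: Ints_cases)
    have "\<bar>real_of_int a\<bar> \<le> R" "\<bar>real_of_int b\<bar> \<le> R"
      using m ab abs_Re_le_cmod[of m] abs_Im_le_cmod[of m] by auto
    then have "a \<in> {-\<lceil>R\<rceil>..\<lceil>R\<rceil>}" "b \<in> {-\<lceil>R\<rceil>..\<lceil>R\<rceil>}"
      by (simp_all, linarith+)
    then show "m \<in> (\<lambda>(a, b). Complex (real_of_int a) (of_int b)) ` ({-\<lceil>R\<rceil>..\<lceil>R\<rceil>} \<times> {-\<lceil>R\<rceil>..\<lceil>R\<rceil>})"
      using ab by (auto simp: image_iff complex_eq_iff)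
  qed
  ultimately show ?thesis by (rule finite_subset[rotated])
qed

text \<open>
  Dirichlet approximation of the slope of \<open>v\<close>. Dividing by the larger coordinate keeps the slope in
  \<open>[-1, 1]\<close>, so that numerator as well as denominator of the approximating fraction are
  bounded in terms of \<open>N\<close> alone.
\<close>
lemma nearly_parallel_Gauss_int:
  assumes N: "N > 0" and v: "norm v = 1"
  obtains m where "m \<in> Gauss_ints" "m \<noteq> 0" "norm m \<le> 2 * real N + 1" "\<bar>cross v m\<bar> < 1 / N"
proof -
  have aux: "\<exists>h k::int. k \<noteq> 0 \<and> \<bar>k\<bar> \<le> N \<and> \<bar>h\<bar> \<le> N + 1 \<and> \<bar>of_int k * b - of_int h * a\<bar> < 1 / N"
    if ab: "\<bar>b\<bar> \<le> \<bar>a\<bar>" "\<bar>a\<bar> \<le> 1" "a \<noteq> 0" for a b :: real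
  proof -
    obtain h k where hk: "0 < k" "k \<le> int N" "\<bar>of_int k * (b/a) - of_int h\<bar> < 1/N"
      by (rule Dirichlet_approx[OF N, of "b/a"])
    have "\<bar>of_int k * b - of_int h * a\<bar> = \<bar>of_int k * (b/a) - of_int h\<bar> * \<bar>a\<bar>"
      using ab(3) by (simp add: field_simps flip: abs_mult)
    also have "\<dots> \<le> \<bar>of_int k * (b/a) - of_int h\<bar>" using ab(2) by (simp add: mult_left_le)
    finally have 1: "\<bar>of_int k * b - of_int h * a\<bar> < 1 / N" using hk by linarith
    have "\<bar>of_int k * (b/a)\<bar> \<le> of_int k * 1"
      using ab hk(1) unfolding abs_mult by (intro mult_mono) (auto simp: divide_simps)
    moreover have "1 / real N \<le> 1" using N by simp
    ultimately have "\<bar>real_of_int h\<bar> \<le> real N + 1" using hk by linarith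
    then have "\<bar>h\<bar> \<le> N + 1" by linarith
    then show ?thesis using 1 hk by (intro exI[of _ h] exI[of _ k]) auto
  qed
  have le1: "\<bar>Re v\<bar> \<le> 1" "\<bar>Im v\<bar> \<le> 1" using abs_Re_le_cmod[of v] abs_Im_le_cmod[of v] v by auto
  have "\<exists>x y::int. (x \<noteq> 0 \<or> y \<noteq> 0) \<and> \<bar>x\<bar> + \<bar>y\<bar> \<le> 2 * N + 1 \<and>
      \<bar>of_int y * Re v - of_int x * Im v\<bar> < 1 / N"
  proof (cases "\<bar>Im v\<bar> \<le> \<bar>Re v\<bar>")
    case True
    then have "Re v \<noteq> 0" using v by (auto simp: cmod_def)
    then obtain h k where "k \<noteq> 0" "\<bar>k\<bar> \<le> int N" "\<bar>h\<bar> \<le> int (N + 1)"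
        "\<bar>of_int k * Im v - of_int h * Re v\<bar> < 1 / N"
      using aux[OF True le1(1)] by blast
    then show ?thesis by (intro exI[of _ k] exI[of _ h]) (auto simp: abs_minus_commute)
  next
    case False
    then obtain h k where "k \<noteq> 0" "\<bar>k\<bar> \<le> int N" "\<bar>h\<bar> \<le> int (N + 1)"
        "\<bar>of_int k * Re v - of_int h * Im v\<bar> < 1 / N"
      using aux[of "Re v" "Im v"] le1 by force
    then show ?thesis by (intro exI[of _ h] exI[of _ k]) auto
  qed
  then obtain x y :: int where xy: "x \<noteq> 0 \<or> y \<noteq> 0" "\<bar>x\<bar> + \<bar>y\<bar> \<le> 2 * N + 1"
      "\<bar>of_int y * Re v - of_int x * Im v\<bar> < 1 / N" by auto
  show thesis
  proof
    show "Complex x y \<in> Gauss_ints" by (simp add: Gauss_ints_def)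
    show "Complex x y \<noteq> 0" using xy by (simp add: complex_eq_iff)
    have "norm (Complex x y) \<le> of_int (\<bar>x\<bar> + \<bar>y\<bar>)" using cmod_le[of "Complex x y"] by simp
    then show "norm (Complex x y) \<le> 2 * real N + 1" using xy(2) by linarith
    show "\<bar>cross v (Complex x y)\<bar> < 1 / N" using xy(3) by (simp add: cross_def algebra_simps)
  qed
qed

text \<open>
  A lattice vector nearly parallel to \<open>v\<close> either witnesses that \<open>v\<close> is sweeping or is exactly
  parallel to \<open>v\<close>. The bound on its length leaves finitely many candidates for the second
  case, and each determines \<open>v\<close> up to sign.
\<close>
lemma finite_not_sweeping:
  assumes "d > 0"
  shows "finite {v. norm v = 1 \<and> \<not> sweeping d v}"
proof -
  obtain N where N: "N > 0" "1 / real N < d"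
    using assms by (metis nat_approx_posE zero_less_Suc)
  let ?M = "{m \<in> Gauss_ints. norm m \<le> 2 * real N + 1}"
  have "{v. norm v = 1 \<and> \<not> sweeping d v} \<subseteq> sgn ` ?M \<union> (\<lambda>m. - sgn m) ` ?M"
  proof
    fix v assume v: "v \<in> {v. norm v = 1 \<and> \<not> sweeping d v}"
    then obtain m where m: "m \<in> Gauss_ints" "m \<noteq> 0" "norm m \<le> 2 * real N + 1" "\<bar>cross v m\<bar> < 1 / N"
      using nearly_parallel_Gauss_int[OF N(1), of v] by auto
    then have "cross v m = 0" using v N by (force simp: sweeping_def)
    then have m': "m = (v \<bullet> m) *\<^sub>R v" using parallel_if_cross_zero v by blast
    have "sgn v = v" using v by (simp add: sgn_div_norm)
    then have "sgn m = sgn (v \<bullet> m) *\<^sub>R v"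
      by (subst m') (simp only: sgn_scaleR)
    moreover have "v \<bullet> m \<noteq> 0" using m' m(2) by (metis scaleR_zero_left)
    then have "sgn (v \<bullet> m) = 1 \<or> sgn (v \<bullet> m) = -1" by (auto simp: sgn_if)
    ultimately have "v = sgn m \<or> v = - sgn m" by (metis minus_minus scaleR_minus1_left scaleR_one)
    then show "v \<in> sgn ` ?M \<union> (\<lambda>m. - sgn m) ` ?M" using m(1,3) by blast
  qed
  moreover have "finite ?M" by (rule finite_Gauss_ints_bounded)
  ultimately show ?thesis by (blast intro: finite_subset finite_imageI finite_UnI)
qed

section \<open>Polygons near a boundary point\<close>

lemma polygon_curve_edge:
  assumes "j < n" "0 \<le> u" "u \<le> 1"
  shows "polygon_curve n P ((real j + u) / real n) = vertex P j + u *\<^sub>R P j"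
proof (cases "u = 1")
  case True
  have "nat \<lfloor>real n * ((real j + u) / real n)\<rfloor> = Suc j"
    using assms(1) True by simp
  then show ?thesis
    using assms(1) True by (simp add: polygon_curve_def vertex_def)
next
  case False
  have "\<lfloor>real j + u\<rfloor> = int j"
    using assms False by (simp add: floor_eq_iff)
  then show ?thesis
    using assms(1) by (simp add: polygon_curve_def)
qed

lemma edge_parameter:
  assumes "0 < n" "0 \<le> t" "t \<le> 1"
  obtains j u where "j < n" "0 \<le> u" "u \<le> 1" "t = (real j + u) / real n" "u = 1 \<longrightarrow> t = 1"
proof (cases "t = 1")
  case True
  show thesis
    by (rule that[of "n - 1" 1]) (use True assms(1) in \<open>auto simp: of_nat_diff\<close>)
next
  case False
  then have "real n * t < real n" using assms by simp
  let ?j = "nat \<lfloor>real n * t\<rfloor>"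
  have "0 \<le> real n * t" using assms by simp
  then have j: "real ?j \<le> real n * t" "real n * t < real ?j + 1" by linarith+
  show thesis
  proof (rule that[of ?j "real n * t - real ?j"])
    show "?j < n" using j(1) \<open>real n * t < real n\<close> by linarith
    show "0 \<le> real n * t - real ?j" "real n * t - real ?j \<le> 1"
      "real n * t - real ?j = 1 \<longrightarrow> t = 1" using j by linarith+
    show "t = (real ?j + (real n * t - real ?j)) / real n" using assms(1) by simp
  qed
qed

lemma path_image_polygon_curve:
  assumes "0 < n"
  shows "path_image (polygon_curve n P) = {vertex P j + u *\<^sub>R P j |j u. j < n \<and> 0 \<le> u \<and> u \<le> 1}"
proof (intro set_eqI iffI)
  fix p assume "p \<in> path_image (polygon_curve n P)"
  then obtain t where t: "0 \<le> t" "t \<le> 1" "p = polygon_curve n P t"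
    by (auto simp: path_image_def)
  obtain j u where ju: "j < n" "0 \<le> u" "u \<le> 1" "t = (real j + u) / real n"
    using edge_parameter[OF assms t(1,2)] by metis
  then show "p \<in> {vertex P j + u *\<^sub>R P j |j u. j < n \<and> 0 \<le> u \<and> u \<le> 1}"
    using t(3) polygon_curve_edge[OF ju(1-3), of P] by auto
next
  fix p assume "p \<in> {vertex P j + u *\<^sub>R P j |j u. j < n \<and> 0 \<le> u \<and> u \<le> 1}"
  then obtain j u where ju: "j < n" "0 \<le> u" "u \<le> 1" "p = vertex P j + u *\<^sub>R P j" by auto
  have "real j + 1 \<le> real n" using ju(1) by linarith
  then have "(real j + u) / real n \<in> {0..1}" using ju by (auto simp: divide_simps)
  moreover have "p = polygon_curve n P ((real j + u) / real n)"
    using polygon_curve_edge[OF ju(1-3), of P] ju(4) by simp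
  ultimately show "p \<in> path_image (polygon_curve n P)" unfolding path_image_def by blast
qed

lemma polygon_curve_closed:
  assumes "P \<in> polygons n"
  shows "pathfinish (polygon_curve n P) = pathstart (polygon_curve n P)"
  using assms by (auto simp: pathfinish_def pathstart_def polygon_curve_def vertex_def polygons_def)

text \<open>
  The second alternative is the closing point of the curve: the end of the last edge is the start of
  edge \<open>0\<close>.
\<close>
lemma edges_meet:
  assumes simple: "simple_path (polygon_curve n P)" and "j < n" "k < n"
    and "0 \<le> u" "u \<le> 1" "0 \<le> s" "s < 1"
    and eq: "vertex P j + u *\<^sub>R P j = vertex P k + s *\<^sub>R P k"
  shows "real j + u = real k + s \<or> real j + u = real n \<and> real k + s = 0"
proof -
  let ?t = "(real j + u) / real n" and ?t' = "(real k + s) / real n"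
  have "real j + 1 \<le> real n" "real k + 1 \<le> real n" using assms(2,3) by linarith+
  then have t: "?t \<in> {0..1}" "?t' \<in> {0..1}" "?t' < 1"
    using assms by (auto simp: divide_simps)
  have "polygon_curve n P ?t = polygon_curve n P ?t'"
    using polygon_curve_edge[of j n u P] polygon_curve_edge[of k n s P] assms by simp
  then have "?t = ?t' \<or> ?t = 0 \<and> ?t' = 1 \<or> ?t = 1 \<and> ?t' = 0"
    using simple t unfolding simple_path_def loop_free_def by blast
  moreover have "0 < n" using assms(2) by simp
  ultimately show ?thesis
    using t(3) by (auto simp: divide_simps)
qed

text \<open>
  Inside the disc the set consists of the two radii in the directions \<open>a\<close> and \<open>b\<close>. A point in
  the relative interior of an edge fits this description with \<open>b = - a\<close>, so vertices and edge points
  can be treated together.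
\<close>
definition two_rays_at :: "complex \<Rightarrow> real \<Rightarrow> complex \<Rightarrow> complex \<Rightarrow> complex set \<Rightarrow> bool"
  where "two_rays_at z r a b S \<longleftrightarrow>
    (\<forall>p\<in>ball z r. p \<in> S \<longleftrightarrow> (\<exists>t\<ge>0. p = z + t *\<^sub>R a \<or> p = z + t *\<^sub>R b))"

lemma compact_edges:
  assumes "finite J"
  shows "compact {vertex P j + u *\<^sub>R P j |j u. j \<in> J \<and> 0 \<le> u \<and> u \<le> 1}"
proof -
  have "{vertex P j + u *\<^sub>R P j |j u. j \<in> J \<and> 0 \<le> u \<and> u \<le> 1} =
      (\<Union>j\<in>J. (\<lambda>u. vertex P j + u *\<^sub>R P j) ` {0..1})"
    unfolding image_def Bex_def atLeastAtMost_iff by blast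
  then show ?thesis
    using assms by (auto intro!: compact_UN compact_continuous_image continuous_intros)
qed

text \<open>
  By simplicity of the curve only the edge \<open>k\<close> leaving \<open>z\<close> and the edge \<open>l\<close> arriving at
  \<open>z\<close> contain \<open>z\<close>; the union of the others is compact, hence misses a disc about \<open>z\<close>. In
  the relative interior of an edge, \<open>k\<close> and \<open>l\<close> coincide.
\<close>
lemma polygon_locally_two_rays:
  assumes "nondegenerate n P" "simple_path (polygon_curve n P)" "P \<in> polygons n" "0 < n"
    and z: "z \<in> path_image (polygon_curve n P)"
  obtains r k l where "r > 0" "k < n" "l < n"
    "two_rays_at z r (P k) (- P l) (path_image (polygon_curve n P))"
    "z \<in> vertex P ` {..<n} \<or> k = l"
proof -
  let ?S = "path_image (polygon_curve n P)"
  let ?E = "\<lambda>J. {vertex P j + u *\<^sub>R P j |j u. j \<in> J \<and> 0 \<le> u \<and> u \<le> 1}"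
  have S: "?S = ?E {..<n}" using path_image_polygon_curve[OF assms(4)] by simp
  have away: "\<exists>r>0. ball z r \<inter> ?E J = {}" if "J \<subseteq> {..<n}" "z \<notin> ?E J" for J
  proof -
    have "closed (?E J)"
      using that(1) finite_subset[OF that(1)] by (intro compact_imp_closed compact_edges) auto
    then have "open (- ?E J)" by (rule open_Compl)
    then show ?thesis
      using that(2) unfolding open_contains_ball disjoint_eq_subset_Compl by (meson ComplI)
  qed
  obtain t where t: "0 \<le> t" "t \<le> 1" "z = polygon_curve n P t"
    using z by (auto simp: path_image_def)
  \<comment> \<open>The parameter \<open>s = 1\<close> is avoided, so that a vertex is always the start of edge \<open>k\<close>.\<close>
  have "\<exists>k s. k < n \<and> 0 \<le> s \<and> s < 1 \<and> z = vertex P k + s *\<^sub>R P k"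
  proof (cases "t = 1")
    case True
    then have "z = 0" using t(3) assms(3) by (simp add: polygon_curve_def vertex_def polygons_def)
    then show ?thesis using assms(4) by (intro exI[of _ 0]) (auto simp: vertex_def)
  next
    case False
    obtain j u where "j < n" "0 \<le> u" "u \<le> 1" "t = (real j + u) / real n" "u = 1 \<longrightarrow> t = 1"
      using edge_parameter[OF assms(4) t(1,2)] by metis
    moreover from this have "u < 1" using False by linarith
    ultimately show ?thesis using t(3) polygon_curve_edge by blast
  qed
  then obtain k s where k: "k < n" "0 \<le> s" "s < 1" and zk: "z = vertex P k + s *\<^sub>R P k" by blast
  have Pk: "norm (P k) > 0" using assms(1) k(1) by (simp add: nondegenerate_def)
  show thesis
  proof (cases "s = 0")
    case False
    let ?J = "{..<n} - {k}"
    have "z \<notin> ?E ?J"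
    proof
      assume "z \<in> ?E ?J"
      then obtain j u where j: "j < n" "j \<noteq> k" "0 \<le> u" "u \<le> 1" "z = vertex P j + u *\<^sub>R P j" by auto
      then have "real j + u = real k + s"
        using edges_meet[OF assms(2) j(1) k(1) j(3,4) k(2,3)] zk False k(2) by auto
      then have "real j < real (Suc k)" "real k < real (Suc j)" using j k False by auto
      then show False using j(2) by linarith
    qed
    then obtain r where r: "r > 0" "ball z r \<inter> ?E ?J = {}" using away[of ?J] by blast
    \<comment> \<open>Within this radius the edge \<open>k\<close> does not end.\<close>
    define r' where "r' = min r (min s (1 - s) * norm (P k))"
    have "two_rays_at z r' (P k) (- P k) ?S"
      unfolding two_rays_at_def
    proof (intro ballI iffI)
      fix p assume p: "p \<in> ball z r'" "p \<in> ?S"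
      then have "p \<in> ball z r" by (simp add: r'_def)
      then have "p \<notin> ?E ?J" using r(2) by blast
      then obtain u where "p = vertex P k + u *\<^sub>R P k" using p(2) S by blast
      then have "p = z + (u - s) *\<^sub>R P k" "p = z + (s - u) *\<^sub>R (- P k)"
        using zk by (auto simp: algebra_simps)
      then show "\<exists>t\<ge>0. p = z + t *\<^sub>R P k \<or> p = z + t *\<^sub>R (- P k)"
        by (metis diff_ge_0_iff_ge linear)
    next
      fix p assume p: "p \<in> ball z r'" and "\<exists>t\<ge>0. p = z + t *\<^sub>R P k \<or> p = z + t *\<^sub>R (- P k)"
      then obtain t where t: "p = z + t *\<^sub>R P k" by (metis scaleR_minus_left scaleR_minus_right)
      then have "\<bar>t\<bar> * norm (P k) < min s (1 - s) * norm (P k)"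
        using p by (auto simp: r'_def dist_norm)
      then have "\<bar>t\<bar> < min s (1 - s)" using Pk by simp
      then have "0 \<le> s + t" "s + t \<le> 1" by auto
      moreover have "p = vertex P k + (s + t) *\<^sub>R P k" using t zk by (simp add: algebra_simps)
      ultimately show "p \<in> ?S" unfolding S using k(1) by blast
    qed
    moreover have "r' > 0" using r(1) k False Pk by (auto simp: r'_def)
    ultimately show thesis using that[of r' k k] k(1) by auto
  next
    case True
    define l where "l = (if k = 0 then n - 1 else k - 1)"
    have l: "l < n" using k(1) by (auto simp: l_def)
    have Pl: "norm (P l) > 0" using assms(1) l by (simp add: nondegenerate_def)
    have "vertex P l + P l = vertex P (Suc l)" by (simp add: vertex_def)
    also have "\<dots> = vertex P k"
    proof (cases "k = 0")
      case True
      then have "Suc l = n" using k(1) by (simp add: l_def)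
      then show ?thesis using assms(3) True by (simp add: vertex_def polygons_def)
    qed (simp add: l_def)
    finally have zl: "z = vertex P l + P l" using zk True by simp
    let ?J = "{..<n} - {k, l}"
    have "z \<notin> ?E ?J"
    proof
      assume "z \<in> ?E ?J"
      then obtain j u where j: "j < n" "j \<noteq> k" "j \<noteq> l" "0 \<le> u" "u \<le> 1" "z = vertex P j + u *\<^sub>R P j" by auto
      then consider "real j + u = real k" | "real j + u = real n" "k = 0"
        using edges_meet[OF assms(2) j(1) k(1) j(4,5) k(2,3)] zk True by auto
      then show False
      proof cases
        case 1
        then have "j = k \<or> Suc j = k" using j(4,5) by linarith
        then show False using j l_def by auto
      next
        case 2
        then have "Suc j = n" using j(1,5) by linarith
        then show False using 2 j l_def by auto
      qed
    qed
    then obtain r where r: "r > 0" "ball z r \<inter> ?E ?J = {}" using away[of ?J] by blast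
    define r' where "r' = min r (min (norm (P k)) (norm (P l)))"
    have "two_rays_at z r' (P k) (- P l) ?S"
      unfolding two_rays_at_def
    proof (intro ballI iffI)
      fix p assume p: "p \<in> ball z r'" "p \<in> ?S"
      then have "p \<in> ball z r" by (simp add: r'_def)
      then have "p \<notin> ?E ?J" using r(2) by blast
      then obtain u where u: "0 \<le> u" "u \<le> 1" "p = vertex P k + u *\<^sub>R P k \<or> p = vertex P l + u *\<^sub>R P l"
        using p(2) S by blast
      from u(3) show "\<exists>t\<ge>0. p = z + t *\<^sub>R P k \<or> p = z + t *\<^sub>R (- P l)"
      proof
        assume "p = vertex P k + u *\<^sub>R P k"
        then show ?thesis using zk True u by auto
      next
        assume "p = vertex P l + u *\<^sub>R P l"
        then have "p = z + (1 - u) *\<^sub>R (- P l)" using zl by (simp add: algebra_simps)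
        then show ?thesis using u by (intro exI[of _ "1 - u"]) auto
      qed
    next
      fix p assume p: "p \<in> ball z r'" and "\<exists>t\<ge>0. p = z + t *\<^sub>R P k \<or> p = z + t *\<^sub>R (- P l)"
      then obtain t where t: "t \<ge> 0" "p = z + t *\<^sub>R P k \<or> p = z + t *\<^sub>R (- P l)" by blast
      from t(2) show "p \<in> ?S"
      proof
        assume *: "p = z + t *\<^sub>R P k"
        then have "t * norm (P k) < 1 * norm (P k)" using p t(1) by (auto simp: r'_def dist_norm)
        then have "t < 1" using Pk by simp
        then show ?thesis unfolding S using * t(1) k(1) zk True by (auto intro!: exI[of _ k] exI[of _ t])
      next
        assume *: "p = z + t *\<^sub>R (- P l)"
        then have "t * norm (P l) < 1 * norm (P l)" using p t(1) by (auto simp: r'_def dist_norm)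
        then have "t < 1" using Pl by simp
        moreover have "p = vertex P l + (1 - t) *\<^sub>R P l" using * zl by (simp add: algebra_simps)
        ultimately show ?thesis unfolding S using t(1) l by (auto intro!: exI[of _ l] exI[of _ "1 - t"])
      qed
    qed
    moreover have "r' > 0" using r(1) Pk Pl by (auto simp: r'_def)
    moreover have "z \<in> vertex P ` {..<n}" using zk True k(1) by auto
    ultimately show thesis using that[of r' k l] k(1) l by auto
  qed
qed

section \<open>Boundary points on a line that misses the region\<close>

lemma inside_closed_segment:
  fixes S :: "'a::real_normed_vector set"
  assumes "p \<in> inside S" "closed_segment p q \<inter> S = {}"
  shows "q \<in> inside S"
proof (rule inside_same_component[OF _ assms(1)])
  have "closed_segment p q \<subseteq> connected_component_set (- S) p"
    using assms(2)
    by (intro connected_component_maximal convex_connected convex_closed_segment) auto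
  then show "connected_component (- S) p q" by auto
qed

text \<open>
  Start at a point \<open>p\<close> of the region and walk straight to a point of the line \<open>z + \<real> v\<close>
  just ahead of \<open>z\<close> (\<open>\<epsilon> = 1\<close>) or just behind it (\<open>\<epsilon> = -1\<close>). The line misses the region, so
  the walk crosses one of the two boundary rays. That ray lies on the same side of the line as
  \<open>p\<close>, and its slope lies beyond that of \<open>p\<close> in the direction of the walk. Here
  \<open>\<sigma>\<close> is the side on which \<open>p\<close> lies, and slopes are measured as distance along \<open>v\<close> over
  distance across \<open>v\<close>.
\<close>
lemma boundary_rays_flank:
  assumes v: "norm v = 1" and rays: "two_rays_at z r a b S"
    and ab: "cross v a \<noteq> 0" "cross v b \<noteq> 0"
    and line: "\<And>t. z + t *\<^sub>R v \<notin> inside S"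
    and p: "p \<in> ball z r" "p \<in> inside S"
    and \<sigma>: "\<sigma> = sgn (cross v (p - z))" and \<epsilon>: "\<epsilon> = 1 \<or> \<epsilon> = -1"
  obtains e where "e = a \<or> e = b" "\<sigma> * cross v e > 0" "\<sigma> * cross v (p - z) > 0"
    "\<epsilon> * ((v \<bullet> (p - z)) / (\<sigma> * cross v (p - z))) < \<epsilon> * ((v \<bullet> e) / (\<sigma> * cross v e))"
proof -
  define x where "x = \<sigma> * cross v (p - z)"
  have vv: "v \<bullet> v = 1" using v by (simp add: dot_square_norm)
  have "cross v (p - z) \<noteq> 0"
  proof
    assume "cross v (p - z) = 0"
    then have "p = z + (v \<bullet> (p - z)) *\<^sub>R v"
      using parallel_if_cross_zero[OF v] by (metis add.commute diff_add_cancel)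
    then show False using p(2) line by metis
  qed
  then have x: "x > 0" unfolding x_def \<sigma> by (simp add: sgn_mult_self_eq[symmetric] mult_sgn_abs sgn_if)
  have r: "r > 0" using p(1) by (meson mem_ball zero_le_dist le_less_trans)
  define q where "q = z + (\<epsilon> * (r/2)) *\<^sub>R v"
  have q: "q \<in> ball z r" using r \<epsilon> v by (auto simp: q_def dist_norm)
  obtain w where w: "w \<in> closed_segment p q" "w \<in> S"
    using inside_closed_segment[OF p(2), of q] line q_def by blast
  have "w \<in> ball z r" using w(1) p(1) q convex_ball by (meson closed_segment_subset subsetD)
  then obtain t e where t: "t \<ge> 0" "e = a \<or> e = b" "w = z + t *\<^sub>R e"
    using rays w(2) unfolding two_rays_at_def by metis
  obtain s where s: "0 \<le> s" "s \<le> 1" "w = (1 - s) *\<^sub>R p + s *\<^sub>R q"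
    using w(1) by (auto simp: in_segment)
  have te: "t *\<^sub>R e = (1 - s) *\<^sub>R (p - z) + (s * \<epsilon> * (r/2)) *\<^sub>R v"
    using s(3) t(3) by (simp add: q_def algebra_simps)
  have X: "t * (\<sigma> * cross v e) = (1 - s) * x"
  proof -
    have "t * cross v e = (1 - s) * cross v (p - z)"
      using arg_cong[OF te, of "cross v"] by (simp add: algebra_simps)
    then show ?thesis unfolding x_def by (metis mult.left_commute)
  qed
  have Y: "t * (v \<bullet> e) = (1 - s) * (v \<bullet> (p - z)) + s * \<epsilon> * (r/2)"
    using arg_cong[OF te, of "\<lambda>y. v \<bullet> y"] by (simp add: inner_simps vv)
  have "w \<noteq> p" using w(2) p(2) inside_no_overlap by blast
  then have s0: "s > 0" using s by (cases "s = 0") auto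
  have "\<sigma> * cross v e \<noteq> 0" using ab t(2) x by (auto simp: x_def)
  have s1: "s < 1"
  proof (rule ccontr)
    assume "\<not> s < 1"
    then have "s = 1" using s by simp
    then have "t = 0" using X \<open>\<sigma> * cross v e \<noteq> 0\<close> by simp
    then show False using Y \<open>s = 1\<close> r \<epsilon> by auto
  qed
  then have pos: "t * (\<sigma> * cross v e) > 0" using X x by simp
  then have e: "\<sigma> * cross v e > 0" and t0: "t > 0" using t(1) by (auto simp: zero_less_mult_iff)
  have "(v \<bullet> e) / (\<sigma> * cross v e) = (t * (v \<bullet> e)) / (t * (\<sigma> * cross v e))" using t0 by simp
  also have "\<dots> = (v \<bullet> (p - z)) / x + \<epsilon> * ((s * (r/2)) / ((1 - s) * x))"
    unfolding X Y using s1 x by (simp add: field_simps)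
  finally have "\<epsilon> * ((v \<bullet> e) / (\<sigma> * cross v e)) =
      \<epsilon> * ((v \<bullet> (p - z)) / x) + (\<epsilon> * \<epsilon>) * ((s * (r/2)) / ((1 - s) * x))"
    by (simp only: distrib_left mult.assoc)
  moreover have "\<epsilon> * \<epsilon> = 1" using \<epsilon> by auto
  moreover have "(s * (r/2)) / ((1 - s) * x) > 0" using s0 s1 r x by simp
  ultimately show thesis using that[OF t(2) e] x unfolding x_def by simp
qed

text \<open>
  For \<open>\<sigma> = \<plusminus>1\<close> and \<open>m\<^sub>1 < m\<^sub>2\<close>: near \<open>z\<close> the set coincides with an open convex sector of
  tip \<open>z\<close> on the side \<open>\<sigma>\<close> of the line \<open>z + \<real> v\<close>. Slopes are measured relative to that
  line, as distance along it over distance from it, so the line touches the closed sector only at \<open>z\<close>.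
\<close>
definition sector_at :: "complex \<Rightarrow> real \<Rightarrow> complex \<Rightarrow> real \<Rightarrow> real \<Rightarrow> real \<Rightarrow> complex set \<Rightarrow> bool"
  where "sector_at z r v \<sigma> m\<^sub>1 m\<^sub>2 \<omega> \<longleftrightarrow> (\<forall>p\<in>ball z r. p \<in> \<omega> \<longleftrightarrow>
    0 < \<sigma> * cross v (p - z) \<and>
    m\<^sub>1 * (\<sigma> * cross v (p - z)) < v \<bullet> (p - z) \<and> v \<bullet> (p - z) < m\<^sub>2 * (\<sigma> * cross v (p - z)))"

text \<open>
  Walking from one point of the region near \<open>z\<close> in both directions \<open>v\<close> and \<open>- v\<close> crosses rays
  of different slopes on the same side of the line, so both boundary rays lie on one side and enclose
  every point of the region. Conversely the sector between them is convex and free of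
  boundary points, so the region fills it. In particular the two rays cannot be opposite: this
  rules out glancing in the interior of an edge.
\<close>
lemma inside_is_sector:
  assumes v: "norm v = 1" and rays: "two_rays_at z r a b S"
    and ab: "cross v a \<noteq> 0" "cross v b \<noteq> 0"
    and line: "\<And>t. z + t *\<^sub>R v \<notin> inside S"
    and z: "z \<in> closure (inside S)" and r: "r > 0"
  obtains \<sigma> m\<^sub>1 m\<^sub>2 where "\<sigma> = 1 \<or> \<sigma> = -1" "m\<^sub>1 < m\<^sub>2" "sector_at z r v \<sigma> m\<^sub>1 m\<^sub>2 (inside S)"
    "0 < cross v a * cross v b"
proof -
  define C where "C \<sigma> = (\<lambda>p. \<sigma> * cross v (p - z))" for \<sigma>
  define D where "D = (\<lambda>p. v \<bullet> (p - z))"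
  define slope where "slope \<sigma> e = (v \<bullet> e) / (\<sigma> * cross v e)" for \<sigma> e
  obtain p where p: "p \<in> ball z r" "p \<in> inside S"
    using z r unfolding closure_approachable mem_ball dist_commute[of z] by blast
  define \<sigma> where "\<sigma> = sgn (cross v (p - z))"
  obtain e where e: "e = a \<or> e = b" "\<sigma> * cross v e > 0" "C \<sigma> p > 0" "D p / C \<sigma> p < slope \<sigma> e"
    using boundary_rays_flank[OF assms(1-5) p \<sigma>_def, of 1] unfolding C_def D_def slope_def by auto
  obtain e' where e': "e' = a \<or> e' = b" "\<sigma> * cross v e' > 0" "slope \<sigma> e' < D p / C \<sigma> p"
    using boundary_rays_flank[OF assms(1-5) p \<sigma>_def, of "-1"] unfolding C_def D_def slope_def by auto
  have ee': "{e, e'} = {a, b}" using e e' by auto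
  have \<sigma>: "\<sigma> = 1 \<or> \<sigma> = -1" using e(2) by (auto simp: \<sigma>_def sgn_if split: if_splits)
  have "0 < cross v e * cross v e'" using e(2) e'(2) \<sigma> by (auto simp: mult_neg_neg)
  then have side: "0 < cross v a * cross v b"
    using ee' by (auto simp: doubleton_eq_iff mult.commute)
  define m\<^sub>1 m\<^sub>2 where "m\<^sub>1 = slope \<sigma> e'" and "m\<^sub>2 = slope \<sigma> e"
  define K where "K = {p. 0 < C \<sigma> p \<and> m\<^sub>1 * C \<sigma> p < D p \<and> D p < m\<^sub>2 * C \<sigma> p}"
  have K_iff: "w \<in> K \<longleftrightarrow> 0 < C \<sigma> w \<and> m\<^sub>1 < D w / C \<sigma> w \<and> D w / C \<sigma> w < m\<^sub>2" for w
    by (auto simp: K_def field_simps)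
  have "inside S \<inter> ball z r \<subseteq> K"
  proof
    fix w assume "w \<in> inside S \<inter> ball z r"
    then have w: "w \<in> ball z r" "w \<in> inside S" by auto
    define \<sigma>' where "\<sigma>' = sgn (cross v (w - z))"
    obtain f where f: "f = a \<or> f = b" "\<sigma>' * cross v f > 0" "C \<sigma>' w > 0" "D w / C \<sigma>' w < slope \<sigma>' f"
      using boundary_rays_flank[OF assms(1-5) w \<sigma>'_def, of 1] unfolding C_def D_def slope_def by auto
    obtain f' where f': "f' = a \<or> f' = b" "slope \<sigma>' f' < D w / C \<sigma>' w"
      using boundary_rays_flank[OF assms(1-5) w \<sigma>'_def, of "-1"] unfolding C_def D_def slope_def by auto
    have "\<sigma> * cross v f > 0" using f(1) e(2) e'(2) ee' by (auto simp: doubleton_eq_iff)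
    moreover have "\<sigma>' = 1 \<or> \<sigma>' = -1" using f(2) by (auto simp: \<sigma>'_def sgn_if split: if_splits)
    ultimately have "\<sigma>' = \<sigma>" using f(2) \<sigma> by auto
    moreover have "{slope \<sigma> f, slope \<sigma> f'} \<subseteq> {m\<^sub>1, m\<^sub>2}"
      using f(1) f'(1) ee' by (auto simp: m\<^sub>1_def m\<^sub>2_def doubleton_eq_iff)
    moreover have "m\<^sub>1 < m\<^sub>2" using e(4) e'(3) by (simp add: m\<^sub>1_def m\<^sub>2_def)
    ultimately show "w \<in> K" using f f' unfolding K_iff by auto
  qed
  moreover have "K \<inter> ball z r \<subseteq> inside S"
  proof
    fix w assume w: "w \<in> K \<inter> ball z r"
    have "convex K"
    proof -
      have C: "C \<sigma> ((1 - u) *\<^sub>R x + u *\<^sub>R y) = (1 - u) * C \<sigma> x + u * C \<sigma> y"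
        and D: "D ((1 - u) *\<^sub>R x + u *\<^sub>R y) = (1 - u) * D x + u * D y" for x y u
        by (simp_all add: C_def D_def inner_simps algebra_simps)
      have convex_comb_pos: "0 < (1 - u) * s + u * t" if "0 < s" "0 < t" "0 \<le> u" "u \<le> 1" for s t u :: real
        using that by (cases "u = 0") (auto intro: add_nonneg_pos)
      show ?thesis
        unfolding convex_alt K_def
      proof safe
        fix x y and u :: real
        assume u: "0 \<le> u" "u \<le> 1"
          and "0 < C \<sigma> x" "m\<^sub>1 * C \<sigma> x < D x" "D x < m\<^sub>2 * C \<sigma> x" "0 < C \<sigma> y" "m\<^sub>1 * C \<sigma> y < D y" "D y < m\<^sub>2 * C \<sigma> y"
        then show "0 < C \<sigma> ((1 - u) *\<^sub>R x + u *\<^sub>R y)"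
          "m\<^sub>1 * C \<sigma> ((1 - u) *\<^sub>R x + u *\<^sub>R y) < D ((1 - u) *\<^sub>R x + u *\<^sub>R y)"
          "D ((1 - u) *\<^sub>R x + u *\<^sub>R y) < m\<^sub>2 * C \<sigma> ((1 - u) *\<^sub>R x + u *\<^sub>R y)"
          using convex_comb_pos[of "C \<sigma> x" "C \<sigma> y" u]
            convex_comb_pos[of "D x - m\<^sub>1 * C \<sigma> x" "D y - m\<^sub>1 * C \<sigma> y" u]
            convex_comb_pos[of "m\<^sub>2 * C \<sigma> x - D x" "m\<^sub>2 * C \<sigma> y - D y" u]
          unfolding C D by (auto simp: algebra_simps)
      qed
    qed
    moreover have "p \<in> K" using p e(3,4) e'(3) by (simp add: K_iff m\<^sub>1_def m\<^sub>2_def)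
    ultimately have "closed_segment p w \<subseteq> K \<inter> ball z r"
      using w p(1) by (intro closed_segment_subset convex_Int convex_ball) auto
    moreover have "K \<inter> ball z r \<inter> S = {}"
    proof (rule ccontr)
      assume "K \<inter> ball z r \<inter> S \<noteq> {}"
      then obtain y where y: "y \<in> K" "y \<in> ball z r" "y \<in> S" by blast
      then obtain t g where t: "g = a \<or> g = b" "y = z + t *\<^sub>R g"
        using rays unfolding two_rays_at_def by metis
      then have "0 < t * (\<sigma> * cross v g)" using y(1) by (simp add: K_iff C_def mult.left_commute)
      then have "D y / C \<sigma> y = slope \<sigma> g"
        using t(2) by (auto simp: D_def C_def slope_def divide_simps)
      moreover have "slope \<sigma> g = m\<^sub>1 \<or> slope \<sigma> g = m\<^sub>2"
        using t(1) ee' unfolding m\<^sub>1_def m\<^sub>2_def by (metis doubleton_eq_iff)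
      ultimately show False
        using y(1) unfolding K_iff by auto
    qed
    ultimately show "w \<in> inside S" using inside_closed_segment[OF p(2)] by blast
  qed
  ultimately have "sector_at z r v \<sigma> m\<^sub>1 m\<^sub>2 (inside S)"
    unfolding sector_at_def K_def C_def D_def by blast
  moreover have "m\<^sub>1 < m\<^sub>2" using e(4) e'(3) by (simp add: m\<^sub>1_def m\<^sub>2_def)
  ultimately show thesis using that[OF \<sigma> _ _ side] by blast
qed

section \<open>Order of a glancing point at the tip of a sector\<close>

lemma torus_line_through:
  assumes "proj z \<in> torus_line w v"
  shows "torus_line w v = {proj (z + t *\<^sub>R v) |t. True}"
proof -
  obtain t0 where t0: "proj z = w + proj (t0 *\<^sub>R v)"
    using assms by (auto simp: torus_line_def)
  have "w + proj (t *\<^sub>R v) = proj (z + (t - t0) *\<^sub>R v)" for t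
  proof -
    have "proj z + proj ((t - t0) *\<^sub>R v) = w + proj (t0 *\<^sub>R v + (t - t0) *\<^sub>R v)"
      unfolding t0 proj_add by (simp add: add.assoc)
    then show ?thesis by (simp add: proj_add flip: scaleR_add_left)
  qed
  moreover from this have "proj (z + t *\<^sub>R v) = w + proj ((t + t0) *\<^sub>R v)" for t
    by simp
  ultimately show ?thesis unfolding torus_line_def by blast
qed

lemma short_Gauss_int_parallel:
  assumes "norm v = 1" "\<not> sweeping d v" "m \<in> Gauss_ints" "\<bar>cross v m\<bar> < d"
  shows "cross v m = 0"
  using assms by (auto simp: sweeping_def)

lemma bij_linear_complex:
  fixes A :: "complex \<Rightarrow> complex"
  assumes "linear A" "\<And>q. A q = 0 \<Longrightarrow> q = 0"
  shows "bij A"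
proof -
  have "inj A" using assms linear_injective_0 by blast
  then show ?thesis using assms(1) linear_injective_imp_surjective by (auto simp: bij_def)
qed

text \<open>
  Shear and scale the plane so that \<open>v\<close> becomes vertical and the sector becomes \<open>0 < y < 2 x\<close>. For
  \<open>\<eta> = 1\<close> the inner region with constant \<open>3/2\<close> is \<open>2/3 y \<le> x \<le> 3/2 y\<close>, which the
  sector contains, and the sector lies in \<open>y \<le> 2 x\<close>. What remains is to see that in a small chart
  the line \<open>L\<close> and the nearby parallel lines have a single strand. This holds because a glancing
  direction cannot be sweeping: no lattice vector moves the line sideways by a non-zero
  distance less than \<open>d\<close>. The point is therefore one-sided.
\<close>
lemma sector_glancing_order_1:
  assumes pp: "properly_projected \<omega>" and d: "d > 0" "ball c d \<subseteq> \<omega>"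
    and L: "glancing_line (proj ` \<omega>) v L" "proj z \<in> L" "proj z \<in> frontier (proj ` \<omega>)"
    and z: "z \<in> closure \<omega>" and r: "r > 0"
    and \<sigma>: "\<sigma> = 1 \<or> \<sigma> = -1" and m: "m\<^sub>1 < m\<^sub>2" and sector: "sector_at z r v \<sigma> m\<^sub>1 m\<^sub>2 \<omega>"
  shows "has_order (proj ` \<omega>) v L (proj z) 1"
proof -
  have v: "norm v = 1" using L(1) by (simp add: glancing_line_def)
  have L_eq: "L = {proj (z + t *\<^sub>R v) |t. True}"
    using L(1,2) torus_line_through unfolding glancing_line_def by blast
  have "\<not> sweeping d v"
  proof
    assume "sweeping d v"
    moreover obtain w where "L = torus_line (proj w) v"
      using L(1) proj_surj unfolding glancing_line_def by metis
    ultimately have "L \<inter> proj ` ball c d \<noteq> {}"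
      using sweeping_line_meets_ball[OF v] by blast
    then show False using L(1) d(2) by (auto simp: glancing_line_def)
  qed
  note short = short_Gauss_int_parallel[OF v this]
  obtain r' where r': "r' > 0" "\<And>p. \<lbrakk>p \<in> ball z r'; proj p \<in> proj ` \<omega>\<rbrakk> \<Longrightarrow> p \<in> \<omega>"
    using properly_projected_local[OF pp z] by blast
  \<comment> \<open>Small enough for the sector description, for a single sheet of the region, for injectivity of the projection and for a single strand of the line even after a shift by \<open>\<rho>\<close>.\<close>
  define \<rho> where "\<rho> = min (min r r') (min (1/2) (d/2))"
  have \<rho>: "\<rho> > 0" "\<rho> \<le> r" "\<rho> \<le> r'" "\<rho> \<le> 1/2" "2 * \<rho> \<le> d"
    using r r'(1) d(1) by (auto simp: \<rho>_def)
  define B where "B = ball z \<rho>"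
  define x where "x q = \<sigma> * cross v q" for q
  define y where "y q = 2 * (v \<bullet> q - m\<^sub>1 * x q) / (m\<^sub>2 - m\<^sub>1)" for q
  define A where "A q = Complex (x q) (y q)" for q
  have "linear A"
    by (rule linearI)
      (auto simp: A_def x_def y_def complex_eq_iff inner_simps add_divide_distrib diff_divide_distrib algebra_simps)
  have "bij A"
  proof (rule bij_linear_complex[OF \<open>linear A\<close>])
    fix q assume "A q = 0"
    then have "x q = 0" "y q = 0" by (auto simp: A_def complex_eq_iff)
    then have "cross v q = 0" "v \<bullet> q = 0" using \<sigma> m by (auto simp: x_def y_def)
    then show "q = 0" using parallel_if_cross_zero[OF v] by force
  qed
  have inj: "inj_on proj B" unfolding B_def using \<rho>(4) by (rule inj_on_proj_ball)
  define U where "U = proj ` B"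
  define \<psi> where "\<psi> \<tau> = A (inv_into B proj \<tau> - z)" for \<tau>
  have \<psi>: "\<psi> (proj p) = A (p - z)" if "p \<in> B" for p
    using inj that by (simp add: \<psi>_def)
  have near: "\<bar>cross v (p - z)\<bar> < \<rho>" if "p \<in> B" for p
    using abs_cross_le[of v "p - z"] that v by (simp add: B_def dist_norm norm_minus_commute del: cross_simps)
  have \<omega>: "p \<in> \<omega> \<longleftrightarrow> 0 < x (p - z) \<and> 0 < y (p - z) \<and> y (p - z) < 2 * x (p - z)" if "p \<in> B" for p
  proof -
    have "p \<in> ball z r" using that \<rho>(2) by (auto simp: B_def)
    then show ?thesis
      using sector m unfolding sector_at_def x_def[symmetric] by (auto simp: y_def field_simps)
  qed
  have sheet: "p \<in> \<omega>" if "p \<in> B" "proj p \<in> proj ` \<omega>" for p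
    using r'(2) that \<rho>(3) by (auto simp: B_def)
  have zB: "z \<in> B" using \<rho>(1) by (simp add: B_def)
  have img: "\<psi> ` U = (\<lambda>p. A (p - z)) ` B" 
    unfolding U_def image_image using \<psi> by (rule image_cong[OF refl])
  have img_\<omega>: "\<psi> ` (proj ` \<omega> \<inter> U) = {A (p - z) |p. p \<in> B \<and> p \<in> \<omega>}"
  proof (intro set_eqI iffI)
    fix w assume "w \<in> \<psi> ` (proj ` \<omega> \<inter> U)"
    then obtain \<tau> where \<tau>: "\<tau> \<in> proj ` \<omega>" "\<tau> \<in> U" "w = \<psi> \<tau>" by (elim imageE[of _ \<psi>] IntE)
    then obtain p where "p \<in> B" "\<tau> = proj p" unfolding U_def by (elim imageE)
    with \<tau> have "p \<in> B" "proj p \<in> proj ` \<omega>" "w = \<psi> (proj p)" by simp_all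
    then show "w \<in> {A (p - z) |p. p \<in> B \<and> p \<in> \<omega>}" using sheet \<psi> by blast
  next
    fix w assume "w \<in> {A (p - z) |p. p \<in> B \<and> p \<in> \<omega>}"
    then obtain p where "p \<in> B" "p \<in> \<omega>" "w = \<psi> (proj p)" using \<psi> by auto
    then show "w \<in> \<psi> ` (proj ` \<omega> \<inter> U)" unfolding U_def by blast
  qed
  have chart: "affine_chart \<psi> U"
    unfolding affine_chart_def
  proof (intro exI conjI ballI)
    show "open B" by (simp add: B_def)
    fix p assume "p \<in> B"
    then show "\<psi> (proj p) = A p + - A z" using \<psi> linear_diff[OF \<open>linear A\<close>] by simp
  qed (use inj \<open>linear A\<close> \<open>bij A\<close> U_def in auto)
  have strand: "\<psi> ` (L \<inter> U) = {p \<in> \<psi> ` U. Re p = 0}"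
  proof (intro set_eqI iffI)
    fix w assume "w \<in> \<psi> ` (L \<inter> U)"
    then obtain \<tau> where \<tau>: "\<tau> \<in> L" "\<tau> \<in> U" "w = \<psi> \<tau>" by (elim imageE[of _ \<psi>] IntE)
    then obtain p where "p \<in> B" "\<tau> = proj p" unfolding U_def by (elim imageE)
    moreover obtain t where "\<tau> = proj (z + t *\<^sub>R v)" using \<tau>(1) unfolding L_eq by blast
    ultimately have p: "p \<in> B" "w = \<psi> (proj p)" "proj p = proj (z + t *\<^sub>R v)"
      using \<tau>(3) by simp_all
    then have "cross v (p - (z + t *\<^sub>R v)) = 0"
      using short[of "p - (z + t *\<^sub>R v)"] near[OF p(1)] \<rho> by (simp add: proj_eq_iff_Gauss)
    then have "x (p - z) = 0" by (simp add: x_def)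
    then have "Re w = 0" using p(1,2) \<psi> by (simp add: A_def)
    then show "w \<in> {p \<in> \<psi> ` U. Re p = 0}" using p(1,2) unfolding U_def by blast
  next
    fix w assume "w \<in> {p \<in> \<psi> ` U. Re p = 0}"
    then obtain p where p: "p \<in> B" "w = A (p - z)" "Re w = 0"
      unfolding img by blast
    then have p: "p \<in> B" "w = \<psi> (proj p)" "x (p - z) = 0"
      using \<psi> by (simp_all add: A_def)
    then have "cross v (p - z) = 0" using \<sigma> by (auto simp: x_def)
    then have "p = z + (v \<bullet> (p - z)) *\<^sub>R v"
      using parallel_if_cross_zero[OF v] by (metis add.commute diff_add_cancel)
    then have "proj p \<in> L" unfolding L_eq by (metis (mono_tags, lifting) mem_Collect_eq)
    then show "w \<in> \<psi> ` (L \<inter> U)" using p(1,2) unfolding U_def by blast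
  qed
  have one: "one_sided (proj ` \<omega>) (proj z) v"
    unfolding one_sided_def
  proof (intro exI conjI ballI)
    show "open U" by (simp add: U_def B_def open_proj_image)
    show "proj z \<in> U" using zB by (simp add: U_def)
    \<comment> \<open>The sector lies on side \<open>\<sigma>\<close>, so the lines are shifted towards side \<open>- \<sigma>\<close>.\<close>
    show "norm (- \<sigma> *\<^sub>R (\<i> * v)) = 1" using v \<sigma> by (auto simp: norm_mult)
    show "v \<bullet> (- \<sigma> *\<^sub>R (\<i> * v)) = 0" by (simp add: inner_complex_def)
    show "0 < \<rho>" by (rule \<rho>)
    have cross_w: "cross v (- \<sigma> *\<^sub>R (\<i> * v)) = - \<sigma>"
    proof -
      have "(Re v)\<^sup>2 + (Im v)\<^sup>2 = 1" using v by (metis cmod_power2 one_power2)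
      then have "cross v (\<i> * v) = 1" by (simp add: cross_def power2_eq_square)
      then show ?thesis by simp
    qed
    fix s assume s: "s \<in> {0<..<\<rho>}"
    show "torus_line (proj z + proj (s *\<^sub>R (- \<sigma> *\<^sub>R (\<i> * v)))) v \<inter> U \<inter> proj ` \<omega> = {}"
    proof (rule ccontr)
      assume "\<not> ?thesis"
      then obtain \<tau> where \<tau>: "\<tau> \<in> U" "\<tau> \<in> proj ` \<omega>"
          "\<tau> \<in> torus_line (proj z + proj (s *\<^sub>R (- \<sigma> *\<^sub>R (\<i> * v)))) v" by blast
      obtain p where "p \<in> B" "\<tau> = proj p" using \<tau>(1) unfolding U_def by (elim imageE)
      moreover obtain t where "\<tau> = proj z + proj (s *\<^sub>R (- \<sigma> *\<^sub>R (\<i> * v))) + proj (t *\<^sub>R v)"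
        using \<tau>(3) unfolding torus_line_def by (elim CollectE exE conjE)
      ultimately have p: "p \<in> B" "proj p \<in> proj ` \<omega>"
          "proj p = proj z + proj (s *\<^sub>R (- \<sigma> *\<^sub>R (\<i> * v))) + proj (t *\<^sub>R v)"
        using \<tau>(2) by simp_all
      \<comment> \<open>Two lifts of one torus point differ by a lattice vector, here one with too small a component across \<open>v\<close> to reach another strand.\<close>
      define k where "k = p - (z + s *\<^sub>R (- \<sigma> *\<^sub>R (\<i> * v)) + t *\<^sub>R v)"
      have "k \<in> Gauss_ints"
        using p(3) by (simp add: k_def flip: proj_eq_iff_Gauss proj_add)
      have "cross v k = cross v (p - z) - s * cross v (- \<sigma> *\<^sub>R (\<i> * v)) - t * cross v v"
        by (simp add: k_def algebra_simps)
      then have ck: "cross v k = cross v (p - z) + s * \<sigma>" unfolding cross_w by simp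
      then have "\<bar>cross v k\<bar> < d" using near[OF p(1)] \<sigma> s \<rho>(5) by auto
      then have "cross v (p - z) = - s * \<sigma>" using short[OF \<open>k \<in> Gauss_ints\<close>] ck by simp
      then have "x (p - z) = - s" using \<sigma> by (auto simp: x_def)
      moreover have "x (p - z) > 0" using \<omega>[OF p(1)] sheet[OF p(1,2)] by blast
      ultimately show False using s by simp
    qed
  qed
  have inner: "order_inner (\<psi> ` U) 1 (3/2) \<inter> {p. 0 \<le> Re p \<and> 0 \<le> Im p} \<subseteq> \<psi> ` (proj ` \<omega> \<inter> U)"
  proof
    fix w assume w: "w \<in> order_inner (\<psi> ` U) 1 (3/2) \<inter> {p. 0 \<le> Re p \<and> 0 \<le> Im p}"
    then obtain p where p: "p \<in> B" "w = A (p - z)"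
      unfolding order_inner_def img by blast
    have "w \<noteq> 0" "0 \<le> Re w" "0 \<le> Im w" "2/3 * Im w \<le> Re w" "Re w \<le> 3/2 * Im w"
      using w by (auto simp: order_inner_def)
    then have "0 < Re w" "0 < Im w" "Im w < 2 * Re w" by (auto simp: complex_eq_iff)
    then have "p \<in> \<omega>" unfolding \<omega>[OF p(1)] by (simp add: p(2) A_def)
    then show "w \<in> \<psi> ` (proj ` \<omega> \<inter> U)" unfolding img_\<omega> using p by blast
  qed
  have outer: "\<psi> ` (proj ` \<omega> \<inter> U) \<subseteq> order_outer (\<psi> ` U) 1 2 \<inter> {p. 0 \<le> Re p}"
  proof
    fix w assume "w \<in> \<psi> ` (proj ` \<omega> \<inter> U)"
    then obtain p where p: "p \<in> B" "p \<in> \<omega>" "w = A (p - z)" unfolding img_\<omega> by blast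
    then have "0 < Re w" "0 < Im w" "Im w < 2 * Re w" using \<omega>[OF p(1)] by (auto simp: A_def)
    then show "w \<in> order_outer (\<psi> ` U) 1 2 \<inter> {p. 0 \<le> Re p}"
      using p(1,3) by (auto simp: order_outer_def img)
  qed
  have "\<psi> (proj z) = 0" using \<psi>[OF zB] linear_0[OF \<open>linear A\<close>] by simp
  then have "\<exists>\<psi> U C_out C_in. affine_chart \<psi> U \<and> proj z \<in> U \<and> \<psi> (proj z) = 0 \<and>
      \<psi> ` (L \<inter> U) = {p \<in> \<psi> ` U. Re p = 0} \<and> C_out > C_in \<and> C_in > 1 \<and>
      order_inner (\<psi> ` U) 1 C_in \<inter> {p. 0 \<le> Re p \<and> 0 \<le> Im p} \<subseteq> \<psi> ` (proj ` \<omega> \<inter> U) \<and>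
      \<psi> ` (proj ` \<omega> \<inter> U) \<subseteq> order_outer (\<psi> ` U) 1 C_out \<inter> {p. 0 \<le> Re p}"
    using chart strand inner outer zB
    by (intro exI[of _ \<psi>] exI[of _ U] exI[of _ 2] exI[of _ "3/2"]) (auto simp: U_def)
  then show ?thesis using L one unfolding has_order_def by simp
qed

section \<open>Rotations and perturbations of polygons\<close>

lemma linear_rot: "linear (rot \<theta>)"
  unfolding rot_def by (intro linearI) (auto simp: algebra_simps)

lemma rot_rot [simp]: "rot \<theta> (rot \<theta>' z) = rot (\<theta> + \<theta>') z"
  by (simp add: rot_def cis_mult flip: mult.assoc)

lemma rot_0 [simp]: "rot 0 z = z"
  by (simp add: rot_def)

lemma norm_rot [simp]: "norm (rot \<theta> z) = norm z"
  by (simp add: rot_def norm_mult)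

lemma inj_rot: "inj (rot \<theta>)"
  by (auto simp: inj_def rot_def)

lemma mem_rot_image: "x \<in> rot \<theta> ` S \<longleftrightarrow> rot (- \<theta>) x \<in> S"
proof
  assume "rot (- \<theta>) x \<in> S"
  then have "rot \<theta> (rot (- \<theta>) x) \<in> rot \<theta> ` S" by blast
  then show "x \<in> rot \<theta> ` S" by simp
qed auto

lemma continuous_on_rot: "continuous_on S (rot \<theta>)"
  unfolding rot_def by (intro continuous_intros)

lemma rot_image_inside: "rot \<theta> ` inside S = inside (rot \<theta> ` S)"
proof -
  have *: "rot \<theta> ` inside S \<subseteq> inside (rot \<theta> ` S)" for \<theta> S
  proof
    fix x assume "x \<in> rot \<theta> ` inside S"
    then obtain y where y: "x = rot \<theta> y" "y \<notin> S" "bounded (connected_component_set (- S) y)"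
      by (auto simp: inside_def)
    have "homeomorphism (- S) (- rot \<theta> ` S) (rot \<theta>) (rot (- \<theta>))"
    proof (rule homeomorphismI)
      show "rot \<theta> ` (- S) \<subseteq> - rot \<theta> ` S" "rot (- \<theta>) ` (- rot \<theta> ` S) \<subseteq> - S"
        by (auto simp del: imageE simp: image_subset_iff mem_rot_image)
    qed (auto simp: continuous_on_rot)
    then have "connected_component_set (- rot \<theta> ` S) x = rot \<theta> ` connected_component_set (- S) y"
      using connected_component_set_homeomorphism y by blast
    moreover have "bounded (rot \<theta> ` connected_component_set (- S) y)"
      using y(3) linear_rot by (metis bounded_linear_image linear_conv_bounded_linear)
    ultimately show "x \<in> inside (rot \<theta> ` S)"
      using y(1,2) by (auto simp: inside_def mem_rot_image)
  qed
  have "inside (rot \<theta> ` S) \<subseteq> rot \<theta> ` inside S"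
  proof
    fix x assume "x \<in> inside (rot \<theta> ` S)"
    then have "rot (- \<theta>) x \<in> inside (rot (- \<theta>) ` rot \<theta> ` S)" using * by blast
    then show "x \<in> rot \<theta> ` inside S" by (simp add: mem_rot_image image_image)
  qed
  then show ?thesis using * by blast
qed

lemma polygon_curve_rot: "polygon_curve n (rot_polygon \<theta> P) = rot \<theta> \<circ> polygon_curve n P"
  by (auto simp: fun_eq_iff polygon_curve_def rot_polygon_def vertex_def Let_def
      linear_add[OF linear_rot] linear_sum[OF linear_rot] linear_scale[OF linear_rot])

lemma region_rot: "region n (rot_polygon \<theta> P) = rot \<theta> ` region n P"
  unfolding region_def polygon_curve_rot path_image_compose rot_image_inside ..

lemma rot_polygon_proper:
  assumes "P \<in> proper_polygons n" "\<theta> \<in> Theta (region n P)"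
  shows "rot_polygon \<theta> P \<in> proper_polygons n"
proof -
  have "(\<Sum>j<n. rot_polygon \<theta> P j) = rot \<theta> (\<Sum>j<n. P j)"
    by (simp add: rot_polygon_def linear_sum[OF linear_rot])
  moreover have "simple_path (polygon_curve n (rot_polygon \<theta> P)) = simple_path (polygon_curve n P)"
    unfolding polygon_curve_rot by (rule simple_path_linear_image_eq[OF linear_rot inj_rot])
  moreover have "properly_projected (region n (rot_polygon \<theta> P))"
    using assms(2) by (simp add: region_rot Theta_def)
  moreover have "rot_polygon \<theta> P j = 0 \<longleftrightarrow> P j = 0" for j
    by (simp add: rot_polygon_def rot_def)
  ultimately show ?thesis
    using assms(1)
    by (simp add: proper_polygons_def polygons_def nondegenerate_def no_self_intersections_def
        linear_0[OF linear_rot])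
qed

text \<open>
  The set of differences of points of \<open>closure \<omega>\<close> is compact and avoids the non-zero lattice
  vectors, hence keeps a positive distance \<open>d\<close> from them; a small rotation moves no
  difference by as much as \<open>d\<close>.
\<close>
lemma properly_projected_rot:
  assumes "properly_projected \<omega>"
  obtains \<epsilon> where "\<epsilon> > 0" "\<And>\<theta>. \<bar>\<theta>\<bar> < \<epsilon> \<Longrightarrow> properly_projected (rot \<theta> ` \<omega>)"
proof -
  let ?K = "closure \<omega>" and ?M = "Gauss_ints - {0}"
  let ?D = "{x - y |x y. x \<in> ?K \<and> y \<in> ?K}"
  have \<omega>: "bounded \<omega>" "open \<omega>" "inj_on proj ?K" and K: "compact ?K"
    using assms by (auto simp: properly_projected_def)
  have D: "compact ?D" using K K by (rule compact_differences)
  have "?D \<inter> ?M = {}" using \<omega>(3) by (auto simp: inj_on_proj_iff)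
  then obtain d where d: "d > 0" "\<And>x y. \<lbrakk>x \<in> ?D; y \<in> ?M\<rbrakk> \<Longrightarrow> d \<le> dist x y"
    using separate_compact_closed[OF D closed_subset_Gauss_ints[of ?M]] by blast
  obtain R where R: "\<And>x. x \<in> ?D \<Longrightarrow> norm x \<le> R"
    using compact_imp_bounded[OF D] unfolding bounded_iff by blast
  have "open {\<theta>. norm (cis \<theta> - 1) * R < d}"
    by (intro open_Collect_less continuous_intros)
  moreover have "0 \<in> {\<theta>. norm (cis \<theta> - 1) * R < d}" using d(1) by simp
  ultimately obtain \<epsilon> where \<epsilon>: "\<epsilon> > 0" "ball 0 \<epsilon> \<subseteq> {\<theta>. norm (cis \<theta> - 1) * R < d}"
    using open_contains_ball by blast
  show thesis
  proof (rule that[OF \<epsilon>(1)])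
    fix \<theta> :: real assume "\<bar>\<theta>\<bar> < \<epsilon>"
    then have \<theta>: "norm (cis \<theta> - 1) * R < d" using \<epsilon>(2) by (auto simp: dist_norm)
    have "rot \<theta> ` \<omega> = rot (- \<theta>) -` \<omega>" by (auto simp: mem_rot_image)
    then have "open (rot \<theta> ` \<omega>)"
      using \<omega>(2) continuous_on_rot by (simp add: open_vimage)
    moreover have "bounded (rot \<theta> ` \<omega>)"
      using \<omega>(1) linear_rot by (metis bounded_linear_image linear_conv_bounded_linear)
    moreover have "inj_on proj (closure (rot \<theta> ` \<omega>))"
      unfolding inj_on_proj_iff
    proof (intro ballI impI, rule ccontr)
      fix x y assume xy: "x \<in> closure (rot \<theta> ` \<omega>)" "y \<in> closure (rot \<theta> ` \<omega>)" "x - y \<in> Gauss_ints" "x \<noteq> y"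
      have "closure (rot \<theta> ` \<omega>) \<subseteq> rot \<theta> ` ?K"
        using K continuous_on_rot closure_subset
        by (intro closure_minimal image_mono compact_imp_closed compact_continuous_image) auto
      then obtain a b where ab: "a \<in> ?K" "b \<in> ?K" "x = rot \<theta> a" "y = rot \<theta> b" using xy by blast
      then have D: "a - b \<in> ?D" by blast
      have "d \<le> dist (a - b) (x - y)" using d(2)[OF D] xy by simp
      also have "\<dots> = norm ((cis \<theta> - 1) * (a - b))"
        unfolding dist_norm ab(3,4) rot_def by (subst norm_minus_commute) (simp add: algebra_simps)
      also have "\<dots> \<le> norm (cis \<theta> - 1) * R"
        unfolding norm_mult using R[OF D] by (simp add: mult_left_mono)
      finally show False using \<theta> by simp
    qed
    ultimately show "properly_projected (rot \<theta> ` \<omega>)" by (simp add: properly_projected_def)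
  qed
qed

text \<open>
  The two curves are uniformly closer to each other than to \<open>c\<close>, so they have the same winding number
  about \<open>c\<close>. It is non-zero because \<open>c\<close> is enclosed by the first curve, whence the second
  encloses \<open>c\<close>, too, and with \<open>c\<close> the whole smaller disc, which the second curve does
  not enter.
\<close>
lemma region_contains_ball_stable:
  assumes P: "P \<in> polygons n" "simple_path (polygon_curve n P)"
    and P': "P' \<in> polygons n" "simple_path (polygon_curve n P')"
    and n: "0 < n" and d: "0 < d'" "ball c d \<subseteq> region n P"
    and close: "(\<Sum>j<n. norm (P' j - P j)) < d - d'"
  shows "ball c d' \<subseteq> region n P'"
proof -
  let ?\<gamma> = "polygon_curve n P" and ?\<gamma>' = "polygon_curve n P'"
  have near: "norm (?\<gamma>' t - ?\<gamma> t) < d - d'" if t: "t \<in> {0..1}" for t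
  proof -
    obtain j u where ju: "j < n" "0 \<le> u" "u \<le> 1" "t = (real j + u) / real n"
      using edge_parameter[OF n] t by (metis atLeastAtMost_iff)
    have "?\<gamma>' t - ?\<gamma> t = (\<Sum>i<j. P' i - P i) + u *\<^sub>R (P' j - P j)"
      unfolding ju(4) polygon_curve_edge[OF ju(1-3)]
      by (simp add: vertex_def sum_subtractf algebra_simps)
    also have "norm \<dots> \<le> (\<Sum>i<j. norm (P' i - P i)) + norm (P' j - P j)"
      using ju(2,3) by (intro norm_triangle_mono norm_sum) (auto simp: mult_left_le_one_le)
    also have "\<dots> = (\<Sum>i<Suc j. norm (P' i - P i))" by simp
    also have "\<dots> \<le> (\<Sum>i<n. norm (P' i - P i))"
      using ju(1) by (intro sum_mono2) auto
    finally show ?thesis using close by linarith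
  qed
  have far: "d \<le> norm (?\<gamma> t - c)" if "t \<in> {0..1}" for t
  proof -
    have "?\<gamma> t \<in> path_image ?\<gamma>" using that by (auto simp: path_image_def)
    then have "?\<gamma> t \<notin> ball c d"
      using d(2) inside_no_overlap[of "path_image ?\<gamma>"] unfolding region_def by blast
    then show ?thesis by (simp add: dist_norm norm_minus_commute)
  qed
  have disj: "ball c d' \<inter> path_image ?\<gamma>' = {}"
  proof -
    have "d' \<le> norm (?\<gamma>' t - c)" if "t \<in> {0..1}" for t
      using near[OF that] far[OF that] norm_triangle_ineq[of "?\<gamma>' t - c" "?\<gamma> t - ?\<gamma>' t"]
      by (simp add: norm_minus_commute)
    then show ?thesis by (force simp: path_image_def dist_norm norm_minus_commute)
  qed
  have "0 \<le> (\<Sum>j<n. norm (P' j - P j))" by (simp add: sum_nonneg)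
  then have "0 < d" using close d(1) by linarith
  then have "c \<in> inside (path_image ?\<gamma>)" using d(2) by (auto simp: region_def)
  then have "winding_number ?\<gamma> c \<noteq> 0"
    using simple_closed_path_winding_number_inside[OF P(2)] by (metis neg_equal_0_iff_equal zero_neq_one)
  moreover have "winding_number ?\<gamma>' c = winding_number ?\<gamma> c"
  proof (rule winding_number_nearby_loops_eq)
    show "norm (?\<gamma>' t - ?\<gamma> t) < norm (?\<gamma> t - c)" if "t \<in> {0..1}" for t
      using near[OF that] far[OF that] d(1) by linarith
  qed (use P P' simple_path_imp_path polygon_curve_closed in auto)
  ultimately have "c \<notin> outside (path_image ?\<gamma>')"
    using winding_number_zero_in_outside P' simple_path_imp_path polygon_curve_closed by metis
  moreover have "c \<notin> path_image ?\<gamma>'" using disj centre_in_ball[of c d'] d(1) by blast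
  ultimately have c: "c \<in> inside (path_image ?\<gamma>')" by (metis ComplI UnE inside_Un_outside)
  show ?thesis
    unfolding region_def
  proof
    fix q assume "q \<in> ball c d'"
    then have "closed_segment c q \<subseteq> ball c d'"
      using d(1) by (intro closed_segment_subset convex_ball) auto
    then show "q \<in> inside (path_image ?\<gamma>')"
      using disj by (intro inside_closed_segment[OF c]) blast
  qed
qed

section \<open>Generic polygons\<close>

text \<open>
  Every line parallel to an edge meets the region, and does so for a reason that persists under small
  perturbations: the region contains a disc that is met by all lines in the direction of any edge.
\<close>
definition generic_polygons :: "nat \<Rightarrow> (nat \<Rightarrow> complex) set"
  where "generic_polygons n = {P \<in> proper_polygons n.
    \<exists>c d. 0 < d \<and> ball c d \<subseteq> region n P \<and> (\<forall>j<n. sweeping d (P j))}"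

lemma proper_polygon_Jordan:
  assumes "P \<in> proper_polygons n"
  shows "simple_path (polygon_curve n P)" "region n P \<noteq> {}"
    "frontier (region n P) = path_image (polygon_curve n P)"
  using Jordan_inside_outside[of "polygon_curve n P"] polygon_curve_closed[of P n] assms
  by (auto simp: proper_polygons_def no_self_intersections_def region_def)

text \<open>
  A glancing line cannot have a sweeping direction, since it would meet the disc in the region. So it
  is transversal to all edges, the region is a sector at each boundary point on the line, and the two
  boundary rays there come from different edges.
\<close>
lemma generic_glancing_point:
  assumes P: "P \<in> generic_polygons n" and n: "0 < n"
    and L: "glancing_line (torus_region n P) v L" "\<tau> \<in> L" "\<tau> \<in> frontier (torus_region n P)"
  shows "\<tau> \<in> torus_vertices n P \<and> has_order (torus_region n P) v L \<tau> 1"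
proof -
  define \<omega> where "\<omega> = region n P"
  have proper: "P \<in> proper_polygons n" and pp: "properly_projected \<omega>" and poly: "P \<in> polygons n"
    and nondeg: "nondegenerate n P"
    using P by (auto simp: generic_polygons_def proper_polygons_def \<omega>_def)
  obtain c d where d: "0 < d" "ball c d \<subseteq> \<omega>" "\<And>j. j < n \<Longrightarrow> sweeping d (P j)"
    using P by (auto simp: generic_polygons_def \<omega>_def)
  note J = proper_polygon_Jordan[OF proper]
  have L': "glancing_line (proj ` \<omega>) v L" "\<tau> \<in> frontier (proj ` \<omega>)"
    using L by (auto simp: torus_region_def \<omega>_def)
  have v: "norm v = 1" and miss: "L \<inter> proj ` \<omega> = {}"
    using L'(1) by (auto simp: glancing_line_def)
  obtain w where w: "L = torus_line (proj w) v"
    using L'(1) proj_surj unfolding glancing_line_def by metis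
  obtain z where z: "z \<in> frontier \<omega>" "\<tau> = proj z"
    using frontier_proj_image[of \<omega>] pp L'(2) unfolding properly_projected_def by blast
  have not_sweeping: "\<not> sweeping d v"
    using sweeping_line_meets_ball[OF v, of d w c] miss d(2) w by blast
  have transversal: "cross v (P j) \<noteq> 0" if "j < n" for j
  proof
    assume "cross v (P j) = 0"
    then have par: "P j = (v \<bullet> P j) *\<^sub>R v" by (rule parallel_if_cross_zero[OF v])
    have "v \<bullet> P j \<noteq> 0"
    proof
      assume "v \<bullet> P j = 0"
      then have "P j = 0" using par by simp
      then show False using nondeg that by (simp add: nondegenerate_def)
    qed
    then have "sweeping d v" using sweeping_scale[of "v \<bullet> P j" d v] d(3)[OF that] par by metis
    then show False using not_sweeping by simp
  qed
  have line: "z + t *\<^sub>R v \<notin> \<omega>" for t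
  proof -
    have "proj (z + t *\<^sub>R v) \<in> L"
      using torus_line_through[of z "proj w" v] L(2) w z(2) by blast
    then show ?thesis using miss by blast
  qed
  have "z \<in> path_image (polygon_curve n P)" using z(1) J(3) by (simp add: \<omega>_def)
  then obtain r k l where r: "r > 0" "k < n" "l < n"
      "two_rays_at z r (P k) (- P l) (path_image (polygon_curve n P))"
      "z \<in> vertex P ` {..<n} \<or> k = l"
    using polygon_locally_two_rays[OF nondeg J(1) poly n] by blast
  have zc: "z \<in> closure \<omega>" using z(1) by (simp add: frontier_def)
  obtain \<sigma> m\<^sub>1 m\<^sub>2 where s: "\<sigma> = 1 \<or> \<sigma> = -1" "m\<^sub>1 < m\<^sub>2" "sector_at z r v \<sigma> m\<^sub>1 m\<^sub>2 \<omega>"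
      "0 < cross v (P k) * cross v (- P l)"
    using inside_is_sector[OF v r(4) _ _ _ _ r(1)] transversal[OF r(2)] transversal[OF r(3)] line zc
    unfolding \<omega>_def region_def by auto
  have "k \<noteq> l" using s(4) by (auto simp: mult_less_0_iff)
  then have "\<tau> \<in> torus_vertices n P" using r(5) z(2) by (auto simp: torus_vertices_def)
  moreover have "has_order (proj ` \<omega>) v L (proj z) 1"
    using sector_glancing_order_1[OF pp d(1,2) L'(1) _ _ zc r(1) s(1-3)] L(2) L'(2) z(2) by simp
  ultimately show ?thesis using z(2) by (simp add: torus_region_def \<omega>_def)
qed

lemma sweeping_mono: "\<lbrakk>sweeping d v; d \<le> d'\<rbrakk> \<Longrightarrow> sweeping d' v"
  unfolding sweeping_def by (meson less_le_trans mult_right_mono norm_ge_zero)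

lemma sweeping_smaller:
  assumes "sweeping d v"
  obtains d' where "d' < d" "sweeping d' v"
proof -
  obtain m where m: "m \<in> Gauss_ints" "0 < \<bar>cross v m\<bar>" "\<bar>cross v m\<bar> < d * norm v"
    using assms by (auto simp: sweeping_def)
  then have v: "norm v > 0" by (cases "v = 0") (auto simp: cross_def)
  then have "\<bar>cross v m\<bar> / norm v < d" using m(3) by (simp add: field_simps)
  then obtain d' where "\<bar>cross v m\<bar> / norm v < d'" "d' < d" using dense by blast
  moreover from this have "\<bar>cross v m\<bar> < d' * norm v" using v by (simp add: field_simps)
  ultimately show thesis using that m(1,2) unfolding sweeping_def by blast
qed

lemma open_sweeping: "open {v. sweeping d v}"
proof -
  have "{v. sweeping d v} =
      (\<Union>m\<in>Gauss_ints. {v. 0 < \<bar>cross v m\<bar>} \<inter> {v. \<bar>cross v m\<bar> < d * norm v})"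
    by (auto simp: sweeping_def)
  moreover have "open {v. 0 < \<bar>cross v m\<bar>}" "open {v. \<bar>cross v m\<bar> < d * norm v}" for m
    unfolding cross_def by (intro open_Collect_less continuous_intros)+
  ultimately show ?thesis by (simp add: open_UN open_Int)
qed

text \<open>
  For a slightly smaller radius \<open>d'\<close> all edge directions are still sweeping, which is an open
  condition on the edges, and the concentric disc of radius \<open>d'\<close> stays in the region under perturbations
  of total size below \<open>d - d'\<close>.
\<close>
lemma openin_generic_polygons:
  assumes n: "0 < n"
  shows "openin (top_of_set (proper_polygons n)) (generic_polygons n)"
proof (subst openin_subopen, intro ballI)
  fix P assume P: "P \<in> generic_polygons n"
  then obtain c d where d: "0 < d" "ball c d \<subseteq> region n P" "\<And>j. j < n \<Longrightarrow> sweeping d (P j)"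
    by (auto simp: generic_polygons_def)
  have "\<exists>d'<d. sweeping d' (P j)" if "j < n" for j
    using sweeping_smaller[OF d(3)[OF that]] by blast
  then obtain D where D: "\<And>j. j < n \<Longrightarrow> D j < d \<and> sweeping (D j) (P j)" by metis
  define d' where "d' = Max (insert (d/2) (D ` {..<n}))"
  have d': "d' < d" "d/2 \<le> d'" "\<And>j. j < n \<Longrightarrow> D j \<le> d'"
  proof -
    show "d' < d" using D d(1) by (simp add: d'_def)
    show "d/2 \<le> d'" unfolding d'_def by (rule Max_ge) simp_all
    show "D j \<le> d'" if "j < n" for j unfolding d'_def using that by (intro Max_ge) simp_all
  qed
  define W where "W = {P'. (\<Sum>j<n. norm (P' j - P j)) < d - d'} \<inter> (\<Inter>j<n. {P'. sweeping d' (P' j)})"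
  have coord: "continuous_on UNIV (\<lambda>P'::nat \<Rightarrow> complex. P' j)" for j by simp
  have "open {P'::nat \<Rightarrow> complex. (\<Sum>j<n. norm (P' j - P j)) < d - d'}"
    using coord by (intro open_Collect_less continuous_intros)
  moreover have "open {P'::nat \<Rightarrow> complex. sweeping d' (P' j)}" for j
    using open_vimage[OF open_sweeping[of d'] coord[of j]] by (simp add: vimage_def)
  ultimately have "open W" unfolding W_def by (intro open_Int open_INT) auto
  moreover have "P \<in> W"
  proof -
    have "sweeping d' (P j)" if "j < n" for j
      using D[OF that] d'(3)[OF that] sweeping_mono by blast
    then show ?thesis using d'(1) by (simp add: W_def)
  qed
  moreover have "proper_polygons n \<inter> W \<subseteq> generic_polygons n"
  proof
    fix P' assume P': "P' \<in> proper_polygons n \<inter> W"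
    have "ball c d' \<subseteq> region n P'"
    proof (rule region_contains_ball_stable)
      show "P \<in> polygons n" "simple_path (polygon_curve n P)" "P' \<in> polygons n" "simple_path (polygon_curve n P')"
        using P P' by (auto simp: generic_polygons_def proper_polygons_def no_self_intersections_def)
      show "(\<Sum>j<n. norm (P' j - P j)) < d - d'" using P' by (simp add: W_def)
    qed (use n d d' in auto)
    moreover have "0 < d'" using d d' by linarith
    ultimately show "P' \<in> generic_polygons n" using P' by (auto simp: generic_polygons_def W_def)
  qed
  moreover have "P \<in> proper_polygons n" using P by (simp add: generic_polygons_def)
  ultimately show "\<exists>T. openin (top_of_set (proper_polygons n)) T \<and> P \<in> T \<and> T \<subseteq> generic_polygons n"
    by (intro exI[of _ "proper_polygons n \<inter> W"]) (auto intro: openin_open_Int)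
qed

lemma inj_on_rot_angle:
  assumes "v \<noteq> 0"
  shows "inj_on (\<lambda>\<theta>. rot \<theta> v) {0..<2*pi}"
proof (rule inj_onI)
  fix a b :: real assume ab: "a \<in> {0..<2*pi}" "b \<in> {0..<2*pi}" "rot a v = rot b v"
  have "Arg2pi (cis \<theta>) = \<theta>" if "\<theta> \<in> {0..<2*pi}" for \<theta>
    using that Arg2pi_unique[of 1 \<theta> "cis \<theta>"] by (simp add: cis_conv_exp)
  moreover have "cis a = cis b" using ab(3) assms by (simp add: rot_def)
  ultimately show "a = b" using ab(1,2) by metis
qed

text \<open>
  The rotated region contains the rotated disc, of the same radius \<open>d\<close>. So only angles at which some
  edge takes one of the finitely many directions that are not sweeping can fail, and each edge takes
  each direction at one angle only.
\<close>
lemma finite_nongeneric_rotations: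
  assumes P: "P \<in> proper_polygons n"
  shows "finite {\<theta> \<in> Theta (region n P). rot_polygon \<theta> P \<notin> generic_polygons n}"
proof -
  have "open (region n P)" "nondegenerate n P"
    using P by (auto simp: proper_polygons_def properly_projected_def)
  then obtain c d where d: "0 < d" "ball c d \<subseteq> region n P"
    using proper_polygon_Jordan(2)[OF P] by (meson all_not_in_conv open_contains_ball)
  define Exceptional where "Exceptional = {v. norm v = 1 \<and> \<not> sweeping d v}"
  have "finite Exceptional" unfolding Exceptional_def by (rule finite_not_sweeping[OF d(1)])
  then have "finite {\<theta> \<in> {0..<2*pi}. rot \<theta> (sgn (P j)) \<in> Exceptional}" if "j < n" for j
    using that \<open>nondegenerate n P\<close> finite_vimage_IntI[OF _ inj_on_rot_angle[of "sgn (P j)"]]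
    by (simp add: nondegenerate_def sgn_zero_iff vimage_def Int_def conj_commute)
  then have "finite (\<Union>j<n. {\<theta> \<in> {0..<2*pi}. rot \<theta> (sgn (P j)) \<in> Exceptional})" by simp
  moreover have "{\<theta> \<in> Theta (region n P). rot_polygon \<theta> P \<notin> generic_polygons n} \<subseteq>
      (\<Union>j<n. {\<theta> \<in> {0..<2*pi}. rot \<theta> (sgn (P j)) \<in> Exceptional})"
  proof
    fix \<theta> assume \<theta>: "\<theta> \<in> {\<theta> \<in> Theta (region n P). rot_polygon \<theta> P \<notin> generic_polygons n}"
    have "ball (rot \<theta> c) d \<subseteq> rot \<theta> ` ball c d"
    proof
      fix x assume "x \<in> ball (rot \<theta> c) d"
      then have "norm (rot (- \<theta>) (rot \<theta> c - x)) < d" by (simp add: dist_norm)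
      then have "rot (- \<theta>) x \<in> ball c d"
        unfolding linear_diff[OF linear_rot] by (simp add: dist_norm)
      then show "x \<in> rot \<theta> ` ball c d" unfolding mem_rot_image .
    qed
    then have "ball (rot \<theta> c) d \<subseteq> region n (rot_polygon \<theta> P)"
      using d(2) by (auto simp: region_rot)
    then obtain j where j: "j < n" "\<not> sweeping d (rot_polygon \<theta> P j)"
      using \<theta> rot_polygon_proper[OF P] d(1) unfolding generic_polygons_def by blast
    have "P j \<noteq> 0" using \<open>nondegenerate n P\<close> j(1) by (simp add: nondegenerate_def)
    then have "rot \<theta> (sgn (P j)) = inverse (norm (P j)) *\<^sub>R rot_polygon \<theta> P j"
      by (simp add: sgn_div_norm rot_polygon_def linear_scale[OF linear_rot])
    then have "\<not> sweeping d (rot \<theta> (sgn (P j)))"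
      using j(2) \<open>P j \<noteq> 0\<close> sweeping_scale[of "inverse (norm (P j))" d "rot_polygon \<theta> P j"] by simp
    then have "rot \<theta> (sgn (P j)) \<in> Exceptional" using \<open>P j \<noteq> 0\<close> by (simp add: Exceptional_def norm_sgn)
    then show "\<theta> \<in> (\<Union>j<n. {\<theta> \<in> {0..<2*pi}. rot \<theta> (sgn (P j)) \<in> Exceptional})"
      using \<theta> j(1) by (auto simp: Theta_def)
  qed
  ultimately show ?thesis by (rule finite_subset[rotated])
qed

text \<open>
  All sufficiently small rotations of a proper polygon are again proper, and only finitely many are not
  generic.
\<close>
lemma generic_polygons_dense: "proper_polygons n \<subseteq> closure (generic_polygons n)"
proof
  fix P assume P: "P \<in> proper_polygons n"
  define T where "T = {\<theta> \<in> Theta (region n P). rot_polygon \<theta> P \<in> generic_polygons n}"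
  have "0 \<in> closure T"
    unfolding closure_approachable
  proof (intro allI impI)
    fix e :: real assume "0 < e"
    obtain \<epsilon> where \<epsilon>: "\<epsilon> > 0" "\<And>\<theta>. \<bar>\<theta>\<bar> < \<epsilon> \<Longrightarrow> properly_projected (rot \<theta> ` region n P)"
      using properly_projected_rot P by (auto simp: proper_polygons_def)
    define \<delta> where "\<delta> = min (min e \<epsilon>) (2 * pi)"
    have "0 < \<delta>" using \<open>0 < e\<close> \<epsilon>(1) by (simp add: \<delta>_def)
    then have "infinite {0<..<\<delta>}" by (rule infinite_Ioo)
    then have "infinite ({0<..<\<delta>} - {\<theta> \<in> Theta (region n P). rot_polygon \<theta> P \<notin> generic_polygons n})"
      using finite_nongeneric_rotations[OF P] by simp
    then obtain \<theta> where \<theta>: "\<theta> \<in> {0<..<\<delta>}"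
        "\<theta> \<notin> {\<theta> \<in> Theta (region n P). rot_polygon \<theta> P \<notin> generic_polygons n}"
      by (metis (no_types, lifting) DiffE ex_in_conv finite.emptyI)
    have "\<theta> \<in> Theta (region n P)" using \<theta>(1) \<epsilon>(2) by (auto simp: Theta_def \<delta>_def)
    then have "\<theta> \<in> T" using \<theta>(2) by (simp add: T_def)
    moreover have "dist \<theta> 0 < e" using \<theta>(1) by (simp add: \<delta>_def)
    ultimately show "\<exists>y\<in>T. dist y 0 < e" by blast
  qed
  moreover have "(\<lambda>\<theta>. rot_polygon \<theta> P) ` closure T \<subseteq> closure (generic_polygons n)"
  proof (rule image_closure_subset)
    show "continuous_on (closure T) (\<lambda>\<theta>. rot_polygon \<theta> P)"
      unfolding rot_polygon_def rot_def by (intro continuous_intros)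
    show "(\<lambda>\<theta>. rot_polygon \<theta> P) ` T \<subseteq> closure (generic_polygons n)"
      using closure_subset by (auto simp: T_def)
  qed simp
  ultimately have "rot_polygon 0 P \<in> closure (generic_polygons n)" by blast
  then show "P \<in> closure (generic_polygons n)" by (simp add: rot_polygon_def)
qed

theorem proposition1p18:
  fixes n :: nat
  assumes "n \<ge> 3"
  shows "\<exists>Q. Q \<subseteq> proper_polygons n \<and>
    openin (top_of_set (proper_polygons n)) Q \<and>
    proper_polygons n \<subseteq> closure Q \<and>
    (\<forall>P\<in>Q.
      glancing_set (torus_region n P) \<subseteq> torus_vertices n P \<and>
      (\<forall>z\<in>glancing_set (torus_region n P). \<forall>v L.
        glancing_line (torus_region n P) v L \<and> z \<in> L \<longrightarrow>
        has_order (torus_region n P) v L z 1)) \<and>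
    (\<forall>P\<in>proper_polygons n. \<exists>F. finite F \<and> F \<subseteq> Theta (region n P) \<and>
      (\<forall>\<theta>\<in>Theta (region n P) - F. rot_polygon \<theta> P \<in> Q))"
proof (intro exI[of _ "generic_polygons n"] conjI ballI)
  have n: "0 < n" using assms by simp
  show "generic_polygons n \<subseteq> proper_polygons n" by (auto simp: generic_polygons_def)
  show "openin (top_of_set (proper_polygons n)) (generic_polygons n)"
    by (rule openin_generic_polygons[OF n])
  show "proper_polygons n \<subseteq> closure (generic_polygons n)"
    by (rule generic_polygons_dense)
  show "glancing_set (torus_region n P) \<subseteq> torus_vertices n P" if "P \<in> generic_polygons n" for P
    using generic_glancing_point[OF that n] by (auto simp: glancing_set_def)
  show "\<forall>v L. glancing_line (torus_region n P) v L \<and> z \<in> L \<longrightarrow> has_order (torus_region n P) v L z 1"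
    if "P \<in> generic_polygons n" "z \<in> glancing_set (torus_region n P)" for P z
    using generic_glancing_point[OF that(1) n] that(2) by (auto simp: glancing_set_def)
  show "\<exists>F. finite F \<and> F \<subseteq> Theta (region n P) \<and>
      (\<forall>\<theta>\<in>Theta (region n P) - F. rot_polygon \<theta> P \<in> generic_polygons n)"
    if "P \<in> proper_polygons n" for P
    using finite_nongeneric_rotations[OF that] by (intro exI conjI) auto
qed

end
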